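(* Assume that the continuity and compactness condition holds, that the strict dissipativity condition holds with a minimal optimal periodic orbit $\varPi^\star$, that the local controllability condition at $\varPi^\star$ and the finite-time reachability condition for $\varPi^\star$ hold, and that $\beta$ is a discount function (in the sense of the context). Then for all $x\in\mathbb{X}$ $$\bar V^\beta_\infty(x)=\bar V^{\mathrm{ces}}_\infty(x),$$ where $\bar V^\beta_\infty(x)=\lim_{N\to\infty}\bar V^\beta_N(x)$ and $\bar V^{\mathrm{ces}}_\infty(x)=\lim_{N\to\infty}\bar V^{\mathrm{ces}}_N(x)$ (both limits exist and are finite under these assumptions). If additionally, for all $x\in\mathbb{X}$, $$\inf_{u\in\mathbb{U}^\infty(x)}\limsup_{N\to\infty}\sum_{k=0}^{N-1}\bar\ell(x_u(k,x),u(k))=\inf_{u\in\mathbb{U}^\infty(x)}\liminf_{N\to\infty}\sum_{k=0}^{N-1}\bar\ell(x_u(k,x),u(k)),$$ then, denoting the left-hand side by $\bar V_\infty(x)$, also $\bar V_\infty(x)=\bar V^{\mathrm{ces}}_\infty(x)$ for all $x\in\mathbb{X}$.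
   Context: Notation: $\mathbb{N}=\{1,2,\dots\}$; $\mathbb{I}_{[a,b]}$ is the set of integers in $[a,b]$; $[k]_p$ is the remainder of $k$ modulo $p$. $\alpha\in\mathcal{K}_\infty$ means $\alpha:[0,\infty)\to[0,\infty)$ is continuous, strictly increasing, $\alpha(0)=0$, $\lim_{t\to\infty}\alpha(t)=\infty$. System: $x(k+1)=f(x(k),u(k))$, $\mathbb{X}\subset\mathbb{R}^n$, $\mathbb{U}\subset\mathbb{R}^m$, $f:\mathbb{X}\times\mathbb{U}\to\mathbb{R}^n$, stage cost $\ell:\mathbb{X}\times\mathbb{U}\to\mathbb{R}$. $x_u(0,x)=x$, $x_u(k+1,x)=f(x_u(k,x),u(k))$. $\mathbb{U}^N(x)=\{u\in\mathbb{U}^N: x_u(k,x)\in\mathbb{X}\ \forall k\in\mathbb{I}_{[0,N]}\}$; $\mathbb{U}^\infty(x)$ is the analogous set of infinite sequences. $\ell^\star=\inf_{u\in\mathbb{U}^\infty(x)}\liminf_{N\to\infty}\frac1N\sum_{k=0}^{N-1}\ell(x_u(k,x),u(k))$, assumed to be a constant independent of $x$; $\bar\ell=\ell-\ell^\star$. Cesàro value function: $\bar V^{\mathrm{ces}}_N(x)=\inf_{u\in\mathbb{U}^N(x)}\frac1N\sum_{n=0}^{N-1}\sum_{k=0}^{n}\bar\ell(x_u(k,x),u(k))$. Discount function: $\beta:[0,1]\to[0,1]$ is piecewise continuously differentiable, Lipschitz continuous with constant $L_\beta$, non-increasing, with $\beta(0)=1$, $\beta(1)=0$ and $\limsup_{\xi\to1}\beta'(\xi)<0$.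 Discounted value function: $\bar V^\beta_N(x)=\inf_{u\in\mathbb{U}^N(x)}\sum_{k=0}^{N-1}\beta(\tfrac kN)\,\bar\ell(x_u(k,x),u(k))$. Periodic orbits: a feasible $p$-periodic orbit is a tuple $\varPi=((x_0,u_0),\dots,(x_{p-1},u_{p-1}))\in(\mathbb{X}\times\mathbb{U})^p$, with $\varPi(k)=(x_k,u_k)$ and $\varPi_{\mathbb{X}}=(x_0,\dots,x_{p-1})$, such that $\varPi_{\mathbb{X}}([k+1]_p)=f(\varPi(k))$ for all $k\in\mathbb{I}_{[0,p-1]}$; $S^p_\varPi$ is the set of these. It is minimal if $\varPi_{\mathbb{X}}(k)=\varPi_{\mathbb{X}}(j)$ implies $k=j$. $\|(x,u)\|_\varPi=\min_k\|(x,u)-\varPi(k)\|$ and $\|x\|_{\varPi_{\mathbb{X}}}=\min_k\|x-\varPi_{\mathbb{X}}(k)\|$. $\ell^p(\varPi)=\frac1p\sum_{k=0}^{p-1}\ell(\varPi(k))$. A $p^\star$-periodic orbit $\varPi^\star$ is optimal if $\ell^{p^\star}(\varPi^\star)=\inf_{p\in\mathbb{N},\varPi\in S^p_\varPi}\ell^p(\varPi)$. Conditions. Continuity and compactness: $f,\ell$ are continuous, $\mathbb{X}\times\mathbb{U}$ is compact, and $\mathbb{U}^N(x)\neq\emptyset$ for all $x\in\mathbb{X}$, $N\in\mathbb{N}$. Strict dissipativity: there exist a minimal optimal periodic orbit $\varPi^\star$, a continuous $\lambda:\mathbb{X}\to\mathbb{R}$, $\bar\lambda\in\mathbb{R}$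 with $|\lambda(x)|\le\bar\lambda$ on $\mathbb{X}$, and $\alpha_{\tilde\ell}\in\mathcal{K}_\infty$ with $\tilde\ell(x,u):=\bar\ell(x,u)+\lambda(x)-\lambda(f(x,u))\ge\alpha_{\tilde\ell}(\|(x,u)\|_{\varPi^\star})$ for all $x\in\mathbb{X}$, $u\in\mathbb{U}^1(x)$. Local controllability at $\varPi^\star$: there exist $\kappa>0$, $M'\in\mathbb{N}$, $\rho\in\mathcal{K}_\infty$ such that for all $z\in\varPi^\star_{\mathbb{X}}$ and all $x,y\in\mathbb{X}$ with $\|x-z\|\le\kappa$, $\|y-z\|\le\kappa$ there is $u\in\mathbb{U}^{M'}(x)$ with $x_u(M',x)=y$ and $\|(x_u(k,x),u(k))\|_{\varPi^\star}\le\rho(\max\{\|x\|_{\varPi^\star_{\mathbb{X}}},\|y\|_{\varPi^\star_{\mathbb{X}}}\})$ for all $k\in\mathbb{I}_{[0,M'-1]}$. Finite-time reachability of $\varPi^\star$: for the same $\kappa$ there is an integer $M''\ge1$ such that for all $x\in\mathbb{X}$ there exist $K\in\mathbb{I}_{[0,M'']}$ and $u\in\mathbb{U}^K(x)$ with $\|x_u(K,x)\|_{\varPi^\star_{\mathbb{X}}}\le\kappa$. *)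

theory Defs
  imports "HOL-Analysis.Analysis"
begin

definition class_K_inf :: "(real \<Rightarrow> real) \<Rightarrow> bool" where
  "class_K_inf \<alpha> \<longleftrightarrow>
     \<alpha> \<in> {0..} \<rightarrow> {0..} \<and> continuous_on {0..} \<alpha> \<and> strict_mono_on {0..} \<alpha> \<and> \<alpha> 0 = 0 \<and>
     filterlim \<alpha> at_top at_top"


text \<open>
  Throughout, \<open>X\<close> and \<open>U\<close> are the state and control constraint sets, \<open>f\<close> is the dynamics and
  \<open>l\<close> (or \<open>c\<close>) a stage cost.  Only the values of \<open>f\<close>, \<open>l\<close> on \<open>X \<times> U\<close> are relevant.
\<close>

primrec traj :: "('x \<times> 'u \<Rightarrow> 'x) \<Rightarrow> (nat \<Rightarrow> 'u) \<Rightarrow> 'x \<Rightarrow> nat \<Rightarrow> 'x" where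
  "traj f u x 0 = x"
| "traj f u x (Suc k) = f (traj f u x k, u k)"

text \<open>
  A control sequence of length \<open>N\<close> is represented by a function on all naturals, of which only
  the values at \<open>0, \<dots>, N - 1\<close> matter.
\<close>

definition admissible ::
  "'x set \<Rightarrow> 'u set \<Rightarrow> ('x \<times> 'u \<Rightarrow> 'x) \<Rightarrow> nat \<Rightarrow> 'x \<Rightarrow> (nat \<Rightarrow> 'u) set" where
  "admissible X U f N x = {u. (\<forall>k<N. u k \<in> U) \<and> (\<forall>k\<le>N. traj f u x k \<in> X)}"

definition admissible_inf ::
  "'x set \<Rightarrow> 'u set \<Rightarrow> ('x \<times> 'u \<Rightarrow> 'x) \<Rightarrow> 'x \<Rightarrow> (nat \<Rightarrow> 'u) set" where
  "admissible_inf X U f x = {u. (\<forall>k. u k \<in> U) \<and> (\<forall>k. traj f u x k \<in> X)}"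

definition continuity_compactness ::
  "(real^'n) set \<Rightarrow> (real^'m) set \<Rightarrow> ((real^'n) \<times> (real^'m) \<Rightarrow> real^'n) \<Rightarrow>
   ((real^'n) \<times> (real^'m) \<Rightarrow> real) \<Rightarrow> bool" where
  "continuity_compactness X U f l \<longleftrightarrow>
     continuous_on (X \<times> U) f \<and> continuous_on (X \<times> U) l \<and> compact (X \<times> U) \<and>
     (\<forall>x\<in>X. \<forall>N\<ge>1. admissible X U f N x \<noteq> {})"


text \<open>
  Infima, lower and upper limits are taken in the extended reals, so that none of them depends on
  a convention for unbounded or empty sets of real numbers.
\<close>

definition optimal_average_cost ::
  "'x set \<Rightarrow> 'u set \<Rightarrow> ('x \<times> 'u \<Rightarrow> 'x) \<Rightarrow> ('x \<times> 'u \<Rightarrow> real) \<Rightarrow> 'x \<Rightarrow> ereal" where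
  "optimal_average_cost X U f l x =
     (INF u\<in>admissible_inf X U f x.
        liminf (\<lambda>N. ereal (1 / real N * (\<Sum>k<N. l (traj f u x k, u k)))))"

definition shifted_cost :: "('x \<times> 'u \<Rightarrow> real) \<Rightarrow> real \<Rightarrow> 'x \<times> 'u \<Rightarrow> real" where
  "shifted_cost l lstar w = l w - lstar"

definition cesaro_value ::
  "'x set \<Rightarrow> 'u set \<Rightarrow> ('x \<times> 'u \<Rightarrow> 'x) \<Rightarrow> ('x \<times> 'u \<Rightarrow> real) \<Rightarrow> nat \<Rightarrow> 'x \<Rightarrow> ereal" where
  "cesaro_value X U f c N x =
     (INF u\<in>admissible X U f N x.
        ereal (1 / real N * (\<Sum>n<N. \<Sum>k\<le>n. c (traj f u x k, u k))))"

definition discounted_value ::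
  "'x set \<Rightarrow> 'u set \<Rightarrow> ('x \<times> 'u \<Rightarrow> 'x) \<Rightarrow> ('x \<times> 'u \<Rightarrow> real) \<Rightarrow> (real \<Rightarrow> real) \<Rightarrow>
   nat \<Rightarrow> 'x \<Rightarrow> ereal" where
  "discounted_value X U f c \<beta> N x =
     (INF u\<in>admissible X U f N x.
        ereal (\<Sum>k<N. \<beta> (real k / real N) * c (traj f u x k, u k)))"

definition cesaro_value_inf ::
  "'x set \<Rightarrow> 'u set \<Rightarrow> ('x \<times> 'u \<Rightarrow> 'x) \<Rightarrow> ('x \<times> 'u \<Rightarrow> real) \<Rightarrow> 'x \<Rightarrow> ereal" where
  "cesaro_value_inf X U f c x = lim (\<lambda>N. cesaro_value X U f c N x)"

definition discounted_value_inf ::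
  "'x set \<Rightarrow> 'u set \<Rightarrow> ('x \<times> 'u \<Rightarrow> 'x) \<Rightarrow> ('x \<times> 'u \<Rightarrow> real) \<Rightarrow> (real \<Rightarrow> real) \<Rightarrow>
   'x \<Rightarrow> ereal" where
  "discounted_value_inf X U f c \<beta> x = lim (\<lambda>N. discounted_value X U f c \<beta> N x)"

definition limsup_value ::
  "'x set \<Rightarrow> 'u set \<Rightarrow> ('x \<times> 'u \<Rightarrow> 'x) \<Rightarrow> ('x \<times> 'u \<Rightarrow> real) \<Rightarrow> 'x \<Rightarrow> ereal" where
  "limsup_value X U f c x =
     (INF u\<in>admissible_inf X U f x. limsup (\<lambda>N. ereal (\<Sum>k<N. c (traj f u x k, u k))))"

definition liminf_value ::
  "'x set \<Rightarrow> 'u set \<Rightarrow> ('x \<times> 'u \<Rightarrow> 'x) \<Rightarrow> ('x \<times> 'u \<Rightarrow> real) \<Rightarrow> 'x \<Rightarrow> ereal" where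
  "liminf_value X U f c x =
     (INF u\<in>admissible_inf X U f x. liminf (\<lambda>N. ereal (\<Sum>k<N. c (traj f u x k, u k))))"


text \<open>
  Only the values of \<open>\<beta>\<close> on \<open>[0, 1]\<close> matter.  Piecewise continuous differentiability allows
  finitely many exceptional points, which may include \<open>0\<close> and \<open>1\<close>; hence \<open>deriv \<beta>\<close> is the genuine
  derivative at all points sufficiently close to \<open>1\<close> from the left.
\<close>

definition discount_function :: "(real \<Rightarrow> real) \<Rightarrow> bool" where
  "discount_function \<beta> \<longleftrightarrow>
     \<beta> \<in> {0..1} \<rightarrow> {0..1} \<and>
     \<beta> piecewise_C1_differentiable_on {0..1} \<and>
     (\<exists>L. L-lipschitz_on {0..1} \<beta>) \<and>
     antimono_on {0..1} \<beta> \<and>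
     \<beta> 0 = 1 \<and> \<beta> 1 = 0 \<and>
     Limsup (at_left 1) (\<lambda>\<xi>. ereal (deriv \<beta> \<xi>)) < 0"


text \<open>A \<open>p\<close>-tuple of state-control pairs is a list of length \<open>p\<close>.\<close>

definition periodic_orbits ::
  "'x set \<Rightarrow> 'u set \<Rightarrow> ('x \<times> 'u \<Rightarrow> 'x) \<Rightarrow> nat \<Rightarrow> ('x \<times> 'u) list set" where
  "periodic_orbits X U f p =
     {Q. length Q = p \<and> set Q \<subseteq> X \<times> U \<and> (\<forall>k<p. fst (Q ! ((k + 1) mod p)) = f (Q ! k))}"

definition minimal_orbit :: "('x \<times> 'u) list \<Rightarrow> bool" where
  "minimal_orbit Q \<longleftrightarrow>
     (\<forall>k<length Q. \<forall>j<length Q. fst (Q ! k) = fst (Q ! j) \<longrightarrow> k = j)"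

definition orbit_dist ::
  "('x::real_normed_vector \<times> 'u::real_normed_vector) list \<Rightarrow> 'x \<times> 'u \<Rightarrow> real" where
  "orbit_dist Q w = (MIN k\<in>{..<length Q}. norm (w - Q ! k))"

definition orbit_state_dist :: "('x::real_normed_vector \<times> 'u) list \<Rightarrow> 'x \<Rightarrow> real" where
  "orbit_state_dist Q x = (MIN k\<in>{..<length Q}. norm (x - fst (Q ! k)))"

definition orbit_cost :: "('x \<times> 'u \<Rightarrow> real) \<Rightarrow> ('x \<times> 'u) list \<Rightarrow> real" where
  "orbit_cost l Q = 1 / real (length Q) * (\<Sum>k<length Q. l (Q ! k))"

definition optimal_orbit ::
  "'x set \<Rightarrow> 'u set \<Rightarrow> ('x \<times> 'u \<Rightarrow> 'x) \<Rightarrow> ('x \<times> 'u \<Rightarrow> real) \<Rightarrow> ('x \<times> 'u) list \<Rightarrow> bool" where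
  "optimal_orbit X U f l Q \<longleftrightarrow>
     Q \<in> (\<Union>p\<in>{1..}. periodic_orbits X U f p) \<and>
     ereal (orbit_cost l Q) = (INF R\<in>(\<Union>p\<in>{1..}. periodic_orbits X U f p). ereal (orbit_cost l R))"

definition strict_dissipativity ::
  "(real^'n) set \<Rightarrow> (real^'m) set \<Rightarrow> ((real^'n) \<times> (real^'m) \<Rightarrow> real^'n) \<Rightarrow>
   ((real^'n) \<times> (real^'m) \<Rightarrow> real) \<Rightarrow> real \<Rightarrow> ((real^'n) \<times> (real^'m)) list \<Rightarrow> bool" where
  "strict_dissipativity X U f l lstar Q \<longleftrightarrow>
     minimal_orbit Q \<and> optimal_orbit X U f l Q \<and>
     (\<exists>lam lambar \<alpha>.
        continuous_on X lam \<and> (\<forall>x\<in>X. \<bar>lam x\<bar> \<le> lambar) \<and> class_K_inf \<alpha> \<and>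
        (\<forall>x\<in>X. \<forall>u\<in>admissible X U f 1 x.
           shifted_cost l lstar (x, u 0) + lam x - lam (f (x, u 0)) \<ge> \<alpha> (orbit_dist Q (x, u 0))))"

text \<open>The radius \<open>\<kappa>\<close> is a parameter because the next two conditions share it.\<close>

definition local_controllability ::
  "(real^'n) set \<Rightarrow> (real^'m) set \<Rightarrow> ((real^'n) \<times> (real^'m) \<Rightarrow> real^'n) \<Rightarrow>
   ((real^'n) \<times> (real^'m)) list \<Rightarrow> real \<Rightarrow> bool" where
  "local_controllability X U f Q \<kappa> \<longleftrightarrow>
     \<kappa> > 0 \<and>
     (\<exists>M'\<ge>1. \<exists>\<rho>. class_K_inf \<rho> \<and>
        (\<forall>z\<in>set (map fst Q). \<forall>x\<in>X. \<forall>y\<in>X. norm (x - z) \<le> \<kappa> \<and> norm (y - z) \<le> \<kappa> \<longrightarrow>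
           (\<exists>u\<in>admissible X U f M' x.
              traj f u x M' = y \<and>
              (\<forall>k<M'. orbit_dist Q (traj f u x k, u k)
                        \<le> \<rho> (max (orbit_state_dist Q x) (orbit_state_dist Q y))))))"

definition finite_time_reachability ::
  "(real^'n) set \<Rightarrow> (real^'m) set \<Rightarrow> ((real^'n) \<times> (real^'m) \<Rightarrow> real^'n) \<Rightarrow>
   ((real^'n) \<times> (real^'m)) list \<Rightarrow> real \<Rightarrow> bool" where
  "finite_time_reachability X U f Q \<kappa> \<longleftrightarrow>
     (\<exists>M''\<ge>1. \<forall>x\<in>X. \<exists>K\<le>M''. \<exists>u\<in>admissible X U f K x.
        orbit_state_dist Q (traj f u x K) \<le> \<kappa>)"

end

theory Submission
  imports Defs
begin

text \<open>
  Let \<open>r = c + lam - lam \<circ> f\<close> be the rotated cost, which is nonnegative and vanishes exactly on the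
  orbit. Summation by parts turns the discounted cost of a control into
  \<open>(\<Sum>k<N. \<beta> (k / N) * r (x k, u k)) - lam (x 0) + (\<Sum>k<N. w k * lam (x (k + 1)))\<close>, where
  \<open>w k = \<beta> (k / N) - \<beta> ((k + 1) / N)\<close> are weights of total mass 1, of size \<open>O(1 / N)\<close> and with
  variation tending to 0. Because of the last property, \<open>lam\<close> may be replaced by its mean
  over \<open>p\<close> consecutive steps. If the first sum stays bounded, then, up to a set of times of
  vanishing weight, \<open>p\<close> consecutive states run once through the orbit, so the last sum
  tends to the mean of \<open>lam\<close> over the orbit, uniformly in the control. Hence the discounted values
  converge to the infimum of the undiscounted sum of \<open>r\<close>, plus a constant that does not
  depend on \<open>\<beta>\<close>; the lower bound uses compactness of the set of control sequences. The Cesaro value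
  is the case \<open>\<beta> \<xi> = 1 - \<xi>\<close>. The undiscounted values are compared with the Cesaro value
  through the fact that a Cesaro limit lies between the lower and the upper limit.
\<close>

section \<open>Discount functions\<close>

lemma card_nat_in_interval:
  fixes a b :: real
  assumes "a \<le> b"
  shows "finite {k::nat. a < k \<and> k < b}" "card {k::nat. a < k \<and> k < b} \<le> b - a + 1"
proof -
  have sub: "{k::nat. a < k \<and> k < b} \<subseteq> nat ` {\<lfloor>a\<rfloor> + 1..\<lceil>b\<rceil> - 1}"
  proof
    fix k :: nat assume "k \<in> {k::nat. a < k \<and> k < b}"
    hence "\<lfloor>a\<rfloor> < int k" "int k < \<lceil>b\<rceil>" by (auto simp: floor_less_iff less_ceiling_iff)
    thus "k \<in> nat ` {\<lfloor>a\<rfloor> + 1..\<lceil>b\<rceil> - 1}" by (intro image_eqI[of _ _ "int k"]) auto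
  qed
  show "finite {k::nat. a < k \<and> k < b}" by (rule finite_subset[OF sub]) auto
  have "card {k::nat. a < k \<and> k < b} \<le> card {\<lfloor>a\<rfloor> + 1..\<lceil>b\<rceil> - 1}"
    by (rule order.trans[OF card_mono[OF _ sub] card_image_le]) auto
  also have "\<dots> = nat (\<lceil>b\<rceil> - 1 - \<lfloor>a\<rfloor>)" by simp
  finally have "card {k::nat. a < k \<and> k < b} \<le> nat (\<lceil>b\<rceil> - 1 - \<lfloor>a\<rfloor>)" .
  moreover have "real (nat (\<lceil>b\<rceil> - 1 - \<lfloor>a\<rfloor>)) \<le> b - a + 1"
    using assms by (cases "\<lceil>b\<rceil> - 1 - \<lfloor>a\<rfloor> \<ge> 0") linarith+
  ultimately show "card {k::nat. a < k \<and> k < b} \<le> b - a + 1" by linarith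
qed

definition decrement :: "(real \<Rightarrow> real) \<Rightarrow> nat \<Rightarrow> nat \<Rightarrow> real" where
  "decrement \<beta> N k = \<beta> (real k / real N) - \<beta> (real (Suc k) / real N)"

text \<open>This variation controls the error made by shifting the index in a sum weighted by the
  decrements, which is how averages over a period become available.\<close>

definition decrement_variation :: "(real \<Rightarrow> real) \<Rightarrow> nat \<Rightarrow> real" where
  "decrement_variation \<beta> N = (\<Sum>k<N - 1. \<bar>decrement \<beta> N (Suc k) - decrement \<beta> N k\<bar>)"

text \<open>
  What the argument needs from \<open>\<beta>\<close>. The linear function, whose discounted values are the Cesaro
  values, satisfies it as well, so that both limits are instances of one statement.
\<close>

definition regular_discount :: "(real \<Rightarrow> real) \<Rightarrow> real \<Rightarrow> bool" where
  "regular_discount \<beta> L \<longleftrightarrow>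
     L-lipschitz_on {0..1} \<beta> \<and> antimono_on {0..1} \<beta> \<and> \<beta> 0 = 1 \<and> \<beta> 1 = 0 \<and>
     (\<forall>\<xi>\<in>{0..<1}. 0 < \<beta> \<xi>) \<and> decrement_variation \<beta> \<longlonglongrightarrow> 0"

lemma decrement_le:
  assumes "L-lipschitz_on {0..1} \<beta>" "k < N"
  shows "\<bar>decrement \<beta> N k\<bar> \<le> L / N"
proof -
  have "\<bar>\<beta> (real k / N) - \<beta> (real (Suc k) / N)\<bar> \<le> L * \<bar>real k / N - real (Suc k) / N\<bar>"
    using lipschitz_onD[OF assms(1), of "real k / N" "real (Suc k) / N"] assms(2)
    by (simp add: dist_real_def)
  also have "\<bar>real k / N - real (Suc k) / N\<bar> = 1 / N"
    using assms(2) by (simp add: field_simps)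
  finally show ?thesis by (simp add: decrement_def)
qed

lemma decrement_nonneg:
  assumes "antimono_on {0..1} \<beta>" "k < N"
  shows "0 \<le> decrement \<beta> N k"
  using monotone_onD[OF assms(1), of "real k / N" "real (Suc k) / N"] assms(2)
  by (simp add: decrement_def divide_right_mono)

lemma sum_decrement: "(\<Sum>k<m. decrement \<beta> N k) = \<beta> 0 - \<beta> (real m / N)"
  unfolding decrement_def using sum_lessThan_telescope'[of "\<lambda>k. \<beta> (real k / N)" m] by simp

text \<open>Off the break points every decrement is \<open>- g z / N\<close> with \<open>g\<close>
  the derivative and \<open>z\<close> in the cell, and uniform continuity of \<open>g\<close> makes
  neighbouring decrements differ by at most \<open>e / N\<close>. Cells near break points are
  estimated by the Lipschitz constant alone; they are a small fraction of all cells.\<close>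

lemma decrement_variation_tendsto_0:
  assumes lip: "L-lipschitz_on {0..1} \<beta>" and pw: "\<beta> piecewise_C1_differentiable_on {0..1}"
  shows "decrement_variation \<beta> \<longlonglongrightarrow> 0"
proof (rule LIMSEQ_I)
  fix e' :: real assume "e' > 0"
  define e where "e = e' / 4"
  have e: "e > 0" using \<open>e' > 0\<close> by (simp add: e_def)
  obtain D where D: "finite D" "\<beta> C1_differentiable_on ({0..1} - D)"
    using pw by (auto simp: piecewise_C1_differentiable_on_def)
  then obtain g where g: "\<And>x. x \<in> {0..1} - D \<Longrightarrow> (\<beta> has_field_derivative g x) (at x)"
    and gc: "continuous_on ({0..1} - D) g"
    unfolding C1_differentiable_on_def has_real_derivative_iff_has_vector_derivative by blast
  have L: "L \<ge> 0" using lip by (rule lipschitz_on_nonneg)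
  \<comment> \<open>Each ball of radius \<open>\<delta>\<close> accounts for about
    \<open>2 * \<delta> * N\<close> cells, each contributing at most \<open>2 * L / N\<close>; this
    choice makes the total over \<open>D\<close> at most \<open>e\<close>. The summand 1 keeps the
    denominator positive.\<close>
  define \<delta> where "\<delta> = e / (4 * L * card D + 1)"
  have den: "4 * L * card D + 1 > 0" using L by (intro add_nonneg_pos) auto
  have \<delta>: "\<delta> > 0" using e den by (simp add: \<delta>_def)
  have \<delta>': "card D * (4 * \<delta> * L) \<le> e"
    using e den L by (simp add: \<delta>_def field_simps)
  \<comment> \<open>Deleting open balls leaves a compact set that avoids \<open>D\<close>, so the
    derivative is uniformly continuous on it.\<close>
  define K where "K = {0..1} - (\<Union>d\<in>D. ball d \<delta>)"
  have "compact K" unfolding K_def by (intro compact_diff) auto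
  moreover have KD: "K \<subseteq> {0..1} - D" using \<delta> by (auto simp: K_def)
  ultimately have "uniformly_continuous_on K g"
    by (intro compact_uniformly_continuous continuous_on_subset[OF gc])
  then obtain \<mu> where \<mu>: "\<mu> > 0" "\<And>s t. s \<in> K \<Longrightarrow> t \<in> K \<Longrightarrow> \<bar>s - t\<bar> < \<mu> \<Longrightarrow> \<bar>g s - g t\<bar> < e"
    using e unfolding uniformly_continuous_on_def by (auto simp: dist_real_def)
  \<comment> \<open>The first bound makes the joint length \<open>2 / N\<close> of two adjacent
    cells smaller than \<open>\<mu>\<close>; the second makes the rounding term
    \<open>card D * (6 * L) / N\<close> of the cell count smaller than \<open>e\<close>.\<close>
  obtain N0 :: nat where N0: "N0 > 2 / \<mu>" "N0 > card D * (6 * L) / e"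
  proof -
    obtain N0 :: nat where "N0 > max (2 / \<mu>) (card D * (6 * L) / e)" using reals_Archimedean2 by blast
    thus ?thesis by (intro that[of N0]) auto
  qed
  show "\<exists>N0. \<forall>N\<ge>N0. norm (decrement_variation \<beta> N - 0) < e'"
  proof (intro exI allI impI)
    fix N assume "N \<ge> N0"
    hence N: "real N > 2 / \<mu>" "real N > card D * (6 * L) / e" using N0 by linarith+
    have Npos: "real N > 0" using N(1) \<mu>(1) by (meson divide_pos_pos less_trans zero_less_numeral)
    have N2: "2 / N < \<mu>" using N(1) \<mu>(1) Npos by (simp add: field_simps)
    \<comment> \<open>\<open>bad d k\<close>: the cell from \<open>k / N\<close> to \<open>(k + 2) / N\<close> may meet the ball of radius \<open>\<delta>\<close> around \<open>d\<close>\<close>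
    define bad where "bad d k \<longleftrightarrow> N * (d - \<delta>) - 2 < real k \<and> real k < N * (d + \<delta>)" for d and k :: nat
    have pt: "\<bar>decrement \<beta> N (Suc k) - decrement \<beta> N k\<bar>
        \<le> e / N + (\<Sum>d\<in>D. if bad d k then 2 * L / N else 0)" if k: "k < N - 1" for k
    proof (cases "\<exists>d\<in>D. bad d k")
      case True
      then obtain d where d: "d \<in> D" "bad d k" by auto
      have "\<bar>decrement \<beta> N (Suc k) - decrement \<beta> N k\<bar> \<le> 2 * L / N"
        using decrement_le[OF lip, of k N] decrement_le[OF lip, of "Suc k" N] k by linarith
      also have "\<dots> = (if bad d k then 2 * L / N else 0)" using d by simp
      also have "\<dots> \<le> (\<Sum>d\<in>D. if bad d k then 2 * L / N else 0)"
        using d D(1) L by (intro member_le_sum) auto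
      also have "\<dots> \<le> e / N + \<dots>" using e by simp
      finally show ?thesis .
    next
      case False
      have cell: "t \<in> K" if t: "k / N \<le> t" "t \<le> real (k + 2) / N" for t
      proof -
        have "0 \<le> t" using t(1) Npos by (meson divide_nonneg_pos of_nat_0_le_iff order_trans)
        moreover have "real (k + 2) / N \<le> 1" using k Npos by (simp add: field_simps)
        moreover have "t \<notin> ball d \<delta>" if "d \<in> D" for d
        proof
          assume "t \<in> ball d \<delta>"
          hence "d - \<delta> < t" "t < d + \<delta>" by (auto simp: dist_real_def)
          hence "N * (d - \<delta>) < N * t" "N * t < N * (d + \<delta>)" using Npos by auto
          moreover have "k \<le> N * t" "N * t \<le> k + 2" using t Npos by (auto simp: field_simps)
          ultimately have "bad d k" unfolding bad_def by linarith
          thus False using False that by auto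
        qed
        ultimately show ?thesis using t by (auto simp: K_def)
      qed
      have mvt: "\<exists>z\<in>K. decrement \<beta> N j = - g z / N \<and> \<bar>z - k / N\<bar> \<le> 2 / N \<and> j / N < z \<and> z < Suc j / N"
        if j: "j = k \<or> j = Suc k" for j
      proof -
        have in_cell: "k / N \<le> t \<and> t \<le> real (k + 2) / N"
          if t: "j / N \<le> t" "t \<le> Suc j / N" for t
        proof -
          have "k / N \<le> j / N" "Suc j / N \<le> real (k + 2) / N"
            using j by (auto intro!: divide_right_mono)
          thus ?thesis using t by linarith
        qed
        have "j / N < Suc j / N" using Npos by (simp add: divide_strict_right_mono)
        from MVT2[OF this, of \<beta> g] obtain z where z: "j / N < z" "z < Suc j / N"
          "\<beta> (Suc j / N) - \<beta> (j / N) = (Suc j / N - j / N) * g z"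
          using g KD cell in_cell by blast
        moreover have "Suc j / N - j / N = 1 / N" by (simp add: diff_divide_distrib[symmetric])
        ultimately have "decrement \<beta> N j = - g z / N" by (simp add: decrement_def)
        moreover have "\<bar>z - k / N\<bar> \<le> 2 / N"
          using in_cell[of z] z by (simp add: add_divide_distrib)
        ultimately show ?thesis using cell in_cell z by (intro bexI[of _ z]) auto
      qed
      obtain z z' where z: "z \<in> K" "z' \<in> K" "decrement \<beta> N k = - g z / N"
        "decrement \<beta> N (Suc k) = - g z' / N" "k / N < z" "z < Suc k / N" "Suc k / N < z'" "z' < Suc (Suc k) / N"
        using mvt[of k] mvt[of "Suc k"] by blast
      have "\<bar>z' - z\<bar> < 2 / N"
      proof -
        have "Suc (Suc k) / N = k / N + 2 / N" by (simp add: add_divide_distrib)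
        thus ?thesis using z by linarith
      qed
      hence "\<bar>g z' - g z\<bar> < e" using \<mu>(2) z(1,2) N2 by force
      hence "\<bar>decrement \<beta> N (Suc k) - decrement \<beta> N k\<bar> \<le> e / N"
      proof -
        have "decrement \<beta> N (Suc k) - decrement \<beta> N k = (g z - g z') / N"
          unfolding z by (simp add: diff_divide_distrib)
        hence "\<bar>decrement \<beta> N (Suc k) - decrement \<beta> N k\<bar> = \<bar>g z' - g z\<bar> / N"
          by (simp add: abs_minus_commute)
        thus ?thesis using \<open>\<bar>g z' - g z\<bar> < e\<close> Npos by (simp add: divide_right_mono)
      qed
      moreover have "0 \<le> (\<Sum>d\<in>D. if bad d k then 2 * L / N else 0)"
        using L by (intro sum_nonneg) auto
      ultimately show ?thesis by linarith
    qed
    have cnt: "(\<Sum>k<N - 1. if bad d k then 2 * L / N else 0) \<le> 4 * \<delta> * L + 6 * L / N" for d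
    proof -
      have "(\<Sum>k<N - 1. if bad d k then 2 * L / N else 0)
          = (\<Sum>k\<in>{..<N - 1} \<inter> {k. bad d k}. 2 * L / N)"
        by (simp add: sum.If_cases)
      also have "\<dots> = card ({..<N - 1} \<inter> {k. bad d k}) * (2 * L / N)" by simp
      \<comment> \<open>The bad indices lie in an open interval of length
        \<open>2 * \<delta> * N + 2\<close>, which accounts for the 3.\<close>
      also have "\<dots> \<le> (2 * \<delta> * N + 3) * (2 * L / N)"
      proof (rule mult_right_mono)
        have le: "N * (d - \<delta>) - 2 \<le> N * (d + \<delta>)"
          using Npos \<delta> by (simp add: algebra_simps)
        have "card ({..<N - 1} \<inter> {k. bad d k}) \<le> card {k. bad d k}"
          using card_nat_in_interval(1)[OF le] by (intro card_mono) (auto simp: bad_def)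
        moreover have "card {k. bad d k} \<le> 2 * \<delta> * N + 3"
          using card_nat_in_interval(2)[OF le] by (simp add: bad_def algebra_simps)
        ultimately show "card ({..<N - 1} \<inter> {k. bad d k}) \<le> 2 * \<delta> * N + 3" by linarith
      qed (use L in auto)
      also have "\<dots> = 4 * \<delta> * L + 6 * L / N" using Npos by (simp add: field_simps)
      finally show ?thesis .
    qed
    have "decrement_variation \<beta> N \<le> (\<Sum>k<N - 1. e / N + (\<Sum>d\<in>D. if bad d k then 2 * L / N else 0))"
      unfolding decrement_variation_def using pt by (intro sum_mono) auto
    also have "\<dots> = (N - 1) * (e / N) + (\<Sum>d\<in>D. \<Sum>k<N - 1. if bad d k then 2 * L / N else 0)"
      by (subst sum.swap) (simp add: sum.distrib)
    also have "\<dots> \<le> e + (\<Sum>d\<in>D. 4 * \<delta> * L + 6 * L / N)"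
    proof (rule add_mono)
      show "(N - 1) * (e / N) \<le> e" using Npos e by (simp add: field_simps)
    qed (rule sum_mono, rule cnt)
    also have "\<dots> = e + card D * (4 * \<delta> * L) + card D * (6 * L) / N" by (simp add: algebra_simps)
    also have "\<dots> < e + e + e"
    proof -
      have "card D * (6 * L) / N < e" using N(2) Npos e by (simp add: field_simps)
      thus ?thesis using \<delta>' by linarith
    qed
    also have "\<dots> \<le> e'" using e by (simp add: e_def)
    finally show "norm (decrement_variation \<beta> N - 0) < e'"
      by (simp add: decrement_variation_def sum_nonneg)
  qed
qed

text \<open>A zero before 1 would, by monotonicity, make \<open>\<beta>\<close> vanish up to 1, so
  its derivative would be 0 near 1. This is where the condition on the derivative at 1
  enters.\<close>

lemma discount_function_pos:
  assumes "discount_function \<beta>" "\<xi> \<in> {0..<1}"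
  shows "0 < \<beta> \<xi>"
proof (rule ccontr)
  assume "\<not> 0 < \<beta> \<xi>"
  have anti: "antimono_on {0..1} \<beta>" and b: "\<beta> \<in> {0..1} \<rightarrow> {0..1}"
    and lim: "Limsup (at_left 1) (\<lambda>\<xi>. ereal (deriv \<beta> \<xi>)) < 0"
    using assms(1) by (auto simp: discount_function_def)
  have zero: "\<beta> s = 0" if "\<xi> \<le> s" "s \<le> 1" for s
  proof -
    have "\<beta> s \<le> \<beta> \<xi>" using monotone_onD[OF anti, of \<xi> s] that assms(2) by auto
    moreover have "0 \<le> \<beta> s" using b that assms(2) by (auto simp: Pi_iff)
    ultimately show ?thesis using \<open>\<not> 0 < \<beta> \<xi>\<close> by linarith
  qed
  have "deriv \<beta> s = 0" if "\<xi> < s" "s < 1" for s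
  proof -
    have "(\<beta> has_field_derivative 0) (at s)"
      by (rule has_field_derivative_transform_within_open[where S = "{\<xi><..<1}" and f = "\<lambda>_. 0"])
         (use that zero in auto)
    thus ?thesis by (rule DERIV_imp_deriv)
  qed
  hence "\<forall>\<^sub>F s in at_left 1. deriv \<beta> s = 0"
    unfolding eventually_at_left_field using assms(2) by (intro exI[of _ \<xi>]) auto
  hence "Limsup (at_left 1) (\<lambda>\<xi>. ereal (deriv \<beta> \<xi>)) = Limsup (at_left (1::real)) (\<lambda>\<xi>. 0)"
    by (intro Limsup_eq) (auto elim: eventually_mono)
  also have "\<dots> = 0" by (intro Limsup_const) simp
  finally show False using lim by simp
qed

lemma discount_function_regular:
  assumes "discount_function \<beta>"
  obtains L where "regular_discount \<beta> L"
  using assms discount_function_pos[OF assms] decrement_variation_tendsto_0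
  unfolding discount_function_def regular_discount_def by blast

lemma regular_discount_linear: "regular_discount (\<lambda>\<xi>. 1 - \<xi>) 1"
proof -
  have "decrement (\<lambda>\<xi>. 1 - \<xi>) N k = 1 / N" for N k
    by (simp add: decrement_def diff_divide_distrib[symmetric])
  hence "decrement_variation (\<lambda>\<xi>. 1 - \<xi>) = (\<lambda>_. 0)"
    by (auto simp: decrement_variation_def)
  thus ?thesis
    by (auto simp: regular_discount_def dist_real_def intro!: lipschitz_onI monotone_onI)
qed

section \<open>Trajectories and limits of controls\<close>

lemma traj_shift: "traj f u x (m + k) = traj f (\<lambda>i. u (m + i)) (traj f u x m) k"
  by (induction k) auto

lemma traj_cong: "(\<And>i. i < k \<Longrightarrow> u i = v i) \<Longrightarrow> traj f u x k = traj f v x k"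
  by (induction k) auto

definition append_control :: "nat \<Rightarrow> (nat \<Rightarrow> 'u) \<Rightarrow> (nat \<Rightarrow> 'u) \<Rightarrow> nat \<Rightarrow> 'u" where
  "append_control K u v k = (if k < K then u k else v (k - K))"

lemma traj_append_control:
  "k \<le> K \<Longrightarrow> traj f (append_control K u v) x k = traj f u x k"
  "traj f (append_control K u v) x (K + k) = traj f v (traj f u x K) k"
proof -
  show *: "traj f (append_control K u v) x k = traj f u x k" if "k \<le> K" for k
    using that by (intro traj_cong) (auto simp: append_control_def)
  show "traj f (append_control K u v) x (K + k) = traj f v (traj f u x K) k"
    unfolding traj_shift *[OF order_refl]
    by (intro traj_cong) (auto simp: append_control_def)
qed

lemma append_control_admissible_inf:
  assumes u: "u \<in> admissible X U f K x" and v: "v \<in> admissible_inf X U f (traj f u x K)"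
  shows "append_control K u v \<in> admissible_inf X U f x"
proof -
  have "traj f (append_control K u v) x k \<in> X" for k
  proof (cases "k \<le> K")
    case False
    then obtain j where "k = K + j" by (metis le_Suc_ex nat_le_linear)
    thus ?thesis using v by (auto simp: traj_append_control admissible_inf_def)
  qed (use u in \<open>auto simp: traj_append_control admissible_def\<close>)
  thus ?thesis using u v by (auto simp: admissible_inf_def admissible_def append_control_def)
qed

lemma admissible_shift:
  assumes "u \<in> admissible X U f N x" "m + k \<le> N"
  shows "(\<lambda>i. u (m + i)) \<in> admissible X U f k (traj f u x m)"
  using assms by (auto simp: admissible_def traj_shift[symmetric])

lemma admissible_inf_imp_admissible: "u \<in> admissible_inf X U f x \<Longrightarrow> u \<in> admissible X U f N x"
  by (auto simp: admissible_def admissible_inf_def)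

text \<open>Tychonoff's theorem. Functions carry the product topology, so controls converge when
  they converge at each time.\<close>

lemma compact_constant_product:
  fixes U :: "'u::metric_space set"
  assumes "compact U"
  shows "compact (Pi\<^sub>E (UNIV :: nat set) (\<lambda>_. U))"
  using assms compactin_PiE[of "\<lambda>_::nat. euclidean :: 'u topology" UNIV "\<lambda>_. U"]
  by (simp add: euclidean_product_topology)

text \<open>Compactness of the sequence space gives a subsequence converging at each time, and
  continuity of \<open>f\<close> carries this over to the states. The horizon \<open>H\<close> has
  to lie below \<open>N n\<close> only eventually, so the lemma serves both constant
  \<open>N\<close> and \<open>N n\<close> tending to infinity.\<close>

lemma admissible_limit:
  fixes f :: "'x::metric_space \<times> 'u::metric_space \<Rightarrow> 'x"
  assumes X: "compact X" and U: "compact U" "U \<noteq> {}" and f: "continuous_on (X \<times> U) f"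
    and x: "\<And>n. x n \<in> X" and u: "\<And>n::nat. u n \<in> admissible X U f (N n) (x n)"
  obtains r x' u' where "strict_mono (r :: nat \<Rightarrow> nat)" "x' \<in> X" "\<And>k. u' k \<in> U"
    "\<And>H. \<forall>\<^sub>F n in sequentially. H \<le> N n \<Longrightarrow> u' \<in> admissible X U f H x'"
    "\<And>H k. \<forall>\<^sub>F n in sequentially. H \<le> N n \<Longrightarrow> k \<le> H \<Longrightarrow>
       (\<lambda>n. traj f (u (r n)) (x (r n)) k) \<longlonglongrightarrow> traj f u' x' k"
    "\<And>H k. \<forall>\<^sub>F n in sequentially. H \<le> N n \<Longrightarrow> k < H \<Longrightarrow> (\<lambda>n. u (r n) k) \<longlonglongrightarrow> u' k"
proof -
  obtain u0 where u0: "u0 \<in> U" using U(2) by blast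
  \<comment> \<open>Beyond \<open>N n\<close> the values of \<open>u n\<close> are arbitrary and may
    leave \<open>U\<close>; padding puts the whole sequence into the compact product.\<close>
  define v where "v n k = (if k < N n then u n k else u0)" for n k
  have v: "v n k \<in> U" for n k
    using u[of n] u0 by (auto simp: v_def admissible_def)
  have "seq_compact (X \<times> Pi\<^sub>E (UNIV :: nat set) (\<lambda>_. U))"
    by (intro compact_imp_seq_compact compact_Times X compact_constant_product U)
  moreover have "\<forall>n. (x n, v n) \<in> X \<times> Pi\<^sub>E (UNIV :: nat set) (\<lambda>_. U)"
    using x v by auto
  ultimately obtain l r where l: "l \<in> X \<times> Pi\<^sub>E (UNIV :: nat set) (\<lambda>_. U)" and r: "strict_mono r"
    and lim: "((\<lambda>n. (x n, v n)) \<circ> r) \<longlonglongrightarrow> l"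
    by (rule seq_compactE[where f = "\<lambda>n. (x n, v n)"])
  define x' where "x' = fst l"
  define u' where "u' = snd l"
  have x': "x' \<in> X" and u': "u' k \<in> U" for k using l by (auto simp: x'_def u'_def)
  have limx: "(\<lambda>n. x (r n)) \<longlonglongrightarrow> x'" using tendsto_fst[OF lim] by (simp add: x'_def o_def)
  have "(\<lambda>n. v (r n)) \<longlonglongrightarrow> u'" using tendsto_snd[OF lim] by (simp add: u'_def o_def)
  hence limv: "(\<lambda>n. v (r n) k) \<longlonglongrightarrow> u' k" for k
    by (rule continuous_on_tendsto_compose[OF continuous_on_product_coordinates]) auto
  have ev: "\<forall>\<^sub>F n in sequentially. H \<le> N (r n)" if "\<forall>\<^sub>F n in sequentially. H \<le> N n" for H
    using that eventually_subseq[OF r] by auto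
  have limu: "(\<lambda>n. u (r n) k) \<longlonglongrightarrow> u' k" if "\<forall>\<^sub>F n in sequentially. H \<le> N n" "k < H" for H k
  proof (rule Lim_transform_eventually[OF limv])
    show "\<forall>\<^sub>F n in sequentially. v (r n) k = u (r n) k"
      using ev[OF that(1)] by eventually_elim (use that in \<open>auto simp: v_def\<close>)
  qed
  \<comment> \<open>Convergence and membership in \<open>X\<close> go through one induction:
    \<open>f\<close> is continuous only on \<open>X \<times> U\<close>, so each step needs the
    previous limit to lie there.\<close>
  have limt: "(\<lambda>n. traj f (u (r n)) (x (r n)) k) \<longlonglongrightarrow> traj f u' x' k \<and> traj f u' x' k \<in> X"
    if H: "\<forall>\<^sub>F n in sequentially. H \<le> N n" and "k \<le> H" for H k
    using \<open>k \<le> H\<close>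
  proof (induction k)
    case (Suc k)
    have in_X: "\<forall>\<^sub>F n in sequentially. traj f (u (r n)) (x (r n)) j \<in> X" if "j \<le> H" for j
      using ev[OF H] by eventually_elim (use u that in \<open>auto simp: admissible_def\<close>)
    have in_U: "\<forall>\<^sub>F n in sequentially. u (r n) k \<in> U"
      using ev[OF H] by eventually_elim (use u Suc.prems in \<open>auto simp: admissible_def\<close>)
    have "(\<lambda>n. (traj f (u (r n)) (x (r n)) k, u (r n) k)) \<longlonglongrightarrow> (traj f u' x' k, u' k)"
      using Suc limu[OF H, of k] by (intro tendsto_Pair) auto
    moreover have "\<forall>\<^sub>F n in sequentially. (traj f (u (r n)) (x (r n)) k, u (r n) k) \<in> X \<times> U"
      using in_X[OF Suc_leD[OF Suc.prems]] in_U by eventually_elim auto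
    ultimately have lim: "(\<lambda>n. traj f (u (r n)) (x (r n)) (Suc k)) \<longlonglongrightarrow> traj f u' x' (Suc k)"
      unfolding traj.simps(2) using Suc u' by (intro continuous_on_tendsto_compose[OF f]) auto
    moreover have "traj f u' x' (Suc k) \<in> X"
      using Lim_in_closed_set[OF compact_imp_closed[OF X] in_X[OF Suc.prems] _ lim] by simp
    ultimately show ?case by blast
  qed (use limx x' in auto)
  show ?thesis
  proof (rule that[OF r x' u'])
    show "u' \<in> admissible X U f H x'" if "\<forall>\<^sub>F n in sequentially. H \<le> N n" for H
      using limt[OF that] u' by (auto simp: admissible_def)
  qed (use limt limu in auto)
qed

lemma sum_rotate:
  fixes g :: "nat \<Rightarrow> real"
  shows "(\<Sum>k<p. g ((j + k) mod p)) = (\<Sum>k<p. g k)"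
proof (induction j)
  case (Suc j)
  have "g ((j + 0) mod p) + (\<Sum>k<p. g ((j + Suc k) mod p)) = (\<Sum>k<p. g ((j + k) mod p)) + g ((j + p) mod p)"
    using sum.lessThan_Suc_shift[of "\<lambda>k. g ((j + k) mod p)" p] by simp
  thus ?case using Suc by simp
qed auto

section \<open>Averages and sequences of costs\<close>

text \<open>For a shift by one, summation by parts leaves two boundary terms of size at most
  \<open>e * Y\<close> and an interior term bounded by the variation of \<open>w\<close>; a shift by
  \<open>i\<close> iterates this.\<close>

lemma weighted_sum_shift:
  fixes w y :: "nat \<Rightarrow> real"
  assumes y: "\<And>k. \<bar>y k\<bar> \<le> Y" and w: "\<And>k. k \<le> M \<Longrightarrow> \<bar>w k\<bar> \<le> e"
  shows "\<bar>(\<Sum>k<M. w k * y (k + i)) - (\<Sum>k<M. w k * y k)\<bar>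
    \<le> i * ((2 * e + (\<Sum>k<M. \<bar>w (Suc k) - w k\<bar>)) * Y)"
proof (induction i)
  case (Suc i)
  define z where "z k = y (k + i)" for k
  have z: "\<bar>z k\<bar> \<le> Y" for k using y by (simp add: z_def)
  have "(\<Sum>k<M. w k * z (Suc k)) - (\<Sum>k<M. w k * z k)
      = w M * z M - w 0 * z 0 - (\<Sum>k<M. (w (Suc k) - w k) * z (Suc k))"
    by (induction M) (auto simp: algebra_simps)
  also have "\<bar>\<dots>\<bar> \<le> \<bar>w M * z M\<bar> + \<bar>w 0 * z 0\<bar> + \<bar>\<Sum>k<M. (w (Suc k) - w k) * z (Suc k)\<bar>"
    by linarith
  also have "\<dots> \<le> e * Y + e * Y + (\<Sum>k<M. \<bar>w (Suc k) - w k\<bar> * Y)"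
  proof (intro add_mono)
    show "\<bar>\<Sum>k<M. (w (Suc k) - w k) * z (Suc k)\<bar> \<le> (\<Sum>k<M. \<bar>w (Suc k) - w k\<bar> * Y)"
      using z by (intro order.trans[OF sum_abs] sum_mono) (auto simp: abs_mult intro: mult_left_mono)
  qed (use z w[of M] w[of 0] in \<open>auto simp: abs_mult intro!: mult_mono order.trans[OF abs_ge_zero]\<close>)
  also have "\<dots> = (2 * e + (\<Sum>k<M. \<bar>w (Suc k) - w k\<bar>)) * Y"
    by (simp add: sum_distrib_left algebra_simps)
  finally have "\<bar>(\<Sum>k<M. w k * y (k + Suc i)) - (\<Sum>k<M. w k * y (k + i))\<bar>
      \<le> (2 * e + (\<Sum>k<M. \<bar>w (Suc k) - w k\<bar>)) * Y"
    by (simp add: z_def)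
  thus ?case using Suc by (simp add: ring_distribs)
qed auto

text \<open>The sum with window means is the average of \<open>p\<close> shifted sums
  \<open>S i\<close>, each close to the unshifted \<open>S 0\<close>.\<close>

lemma weighted_sum_mean:
  fixes w y :: "nat \<Rightarrow> real"
  assumes y: "\<And>k. \<bar>y k\<bar> \<le> Y" and w: "\<And>k. k \<le> M \<Longrightarrow> \<bar>w k\<bar> \<le> e" and "0 < p"
  shows "\<bar>(\<Sum>k<M. w k * ((\<Sum>i<p. y (k + i)) / p)) - (\<Sum>k<M. w k * y k)\<bar>
    \<le> p * ((2 * e + (\<Sum>k<M. \<bar>w (Suc k) - w k\<bar>)) * Y)"
proof -
  define S where "S i = (\<Sum>k<M. w k * y (k + i))" for i
  define C where "C = (2 * e + (\<Sum>k<M. \<bar>w (Suc k) - w k\<bar>)) * Y"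
  have Y: "0 \<le> Y" using y[of 0] by linarith
  have "0 \<le> e" using w[of 0] by linarith
  hence C: "0 \<le> C" unfolding C_def using Y by (intro mult_nonneg_nonneg add_nonneg_nonneg sum_nonneg) auto
  have S: "\<bar>S i - S 0\<bar> \<le> p * C" if "i < p" for i
  proof -
    have "\<bar>S i - S 0\<bar> \<le> i * C"
      unfolding S_def C_def using weighted_sum_shift[OF y w] by simp
    also have "\<dots> \<le> p * C" using that C by (intro mult_right_mono) auto
    finally show ?thesis .
  qed
  have "(\<Sum>k<M. w k * ((\<Sum>i<p. y (k + i)) / p)) = (\<Sum>i<p. S i) / p"
    unfolding S_def by (subst sum.swap) (simp add: sum_distrib_left sum_divide_distrib)
  also have "\<dots> - S 0 = (\<Sum>i<p. S i - S 0) / p"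
    using \<open>0 < p\<close> by (simp add: sum_subtractf field_simps)
  also have "\<bar>\<dots>\<bar> \<le> (\<Sum>i<p. p * C) / p"
    unfolding abs_divide abs_of_nat using S
    by (intro divide_right_mono order.trans[OF sum_abs sum_mono]) auto
  also have "\<dots> = p * C" using \<open>0 < p\<close> by simp
  finally show ?thesis by (simp add: S_def C_def)
qed

lemma tendsto_ereal_sandwich:
  assumes "\<And>e. (0::real) < e \<Longrightarrow> \<forall>\<^sub>F n in F. ereal (v - e) \<le> g n \<and> g n \<le> ereal (v + e)"
  shows "(g \<longlongrightarrow> ereal v) F"
proof (rule order_tendstoI)
  fix a assume "a < ereal v"
  then obtain y where y: "a < ereal y" "y < v" using ereal_dense2 by force
  from assms[of "v - y"] y(2) show "\<forall>\<^sub>F n in F. a < g n"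
    by (auto elim!: eventually_mono intro: less_le_trans[OF y(1)])
next
  fix a assume "ereal v < a"
  then obtain y where y: "ereal y < a" "v < y" using ereal_dense2 by force
  from assms[of "y - v"] y(2) show "\<forall>\<^sub>F n in F. g n < a"
    by (auto elim!: eventually_mono intro: le_less_trans[OF _ y(1)])
qed

text \<open>The finitely many exceptional terms have a fixed total excess, which vanishes after
  division by \<open>N\<close>.\<close>

lemma eventually_mean_le:
  fixes s :: "nat \<Rightarrow> real"
  assumes "\<forall>\<^sub>F n in sequentially. s n \<le> B" "0 < e"
  shows "\<forall>\<^sub>F N in sequentially. (\<Sum>n<N. s n) / N \<le> B + e"
proof -
  obtain n0 where n0: "\<And>n. n0 \<le> n \<Longrightarrow> s n \<le> B"
    using assms(1) unfolding eventually_sequentially by blast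
  define A where "A = (\<Sum>n<n0. \<bar>s n - B\<bar>)"
  have A: "(\<Sum>n<N. s n) \<le> A + N * B" for N
  proof -
    have "(\<Sum>n<N. s n) - N * B = (\<Sum>n<N. s n - B)" by (simp add: sum_subtractf)
    also have "\<dots> \<le> (\<Sum>n<N. if n < n0 then \<bar>s n - B\<bar> else 0)"
      using n0 by (intro sum_mono) (auto simp: not_less)
    also have "\<dots> = (\<Sum>n\<in>{..<N} \<inter> {n. n < n0}. \<bar>s n - B\<bar>)" by (simp add: sum.If_cases)
    also have "\<dots> \<le> A" unfolding A_def by (intro sum_mono2) auto
    finally show ?thesis by linarith
  qed
  have "(\<lambda>N. A / real N) \<longlonglongrightarrow> 0" by (rule lim_const_over_n)
  hence "\<forall>\<^sub>F N in sequentially. A / real N < e" using assms(2) by (intro order_tendstoD) auto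
  thus ?thesis using eventually_gt_at_top[of 0]
  proof eventually_elim
    case (elim N)
    have "(\<Sum>n<N. s n) / N \<le> (A + N * B) / N" using A by (intro divide_right_mono) auto
    also have "\<dots> = A / N + B" using elim by (simp add: add_divide_distrib)
    finally show ?case using elim by linarith
  qed
qed

text \<open>The term \<open>g k\<close> occurs in exactly \<open>N - k\<close> of the partial sums.
  This identifies Cesaro values with discounted values for the linear discount.\<close>

lemma mean_partial_sums:
  fixes g :: "nat \<Rightarrow> real"
  shows "1 / real N * (\<Sum>n<N. \<Sum>k\<le>n. g k) = (\<Sum>k<N. (1 - real k / real N) * g k)"
proof (cases "N = 0")
  case False
  have "(\<Sum>n<m. \<Sum>k\<le>n. g k) = (\<Sum>k<m. (real m - real k) * g k)" for m
    by (induction m) (auto simp: algebra_simps sum.distrib sum_subtractf simp flip: lessThan_Suc_atMost)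
  thus ?thesis using False by (simp add: sum_distrib_left field_simps)
qed auto

lemma cesaro_eq_discounted:
  "cesaro_value X U f c N x = discounted_value X U f c (\<lambda>\<xi>. 1 - \<xi>) N x"
  unfolding cesaro_value_def discounted_value_def mean_partial_sums ..

section \<open>The rotated cost of a dissipative system\<close>

text \<open>The cost \<open>c\<close> stands for the shifted cost, and dissipativity is phrased for
  a single control value with successor in \<open>X\<close>. The controllability conditions enter
  later, through the nonemptiness of \<open>summable_controls x\<close>.\<close>

locale dissipative_orbit =
  fixes X :: "'x::real_normed_vector set" and U :: "'u::real_normed_vector set"
    and f :: "'x \<times> 'u \<Rightarrow> 'x" and c :: "'x \<times> 'u \<Rightarrow> real"
    and lam :: "'x \<Rightarrow> real" and lambar :: real and \<alpha> :: "real \<Rightarrow> real"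
    and Q :: "('x \<times> 'u) list"
  assumes compact_X: "compact X" and compact_U: "compact U"
    and cont_f: "continuous_on (X \<times> U) f" and cont_c: "continuous_on (X \<times> U) c"
    and cont_lam: "continuous_on X lam" and lam_bound: "\<And>x. x \<in> X \<Longrightarrow> \<bar>lam x\<bar> \<le> lambar"
    and \<alpha>: "class_K_inf \<alpha>"
    and dissipative: "\<And>x u. x \<in> X \<Longrightarrow> u \<in> U \<Longrightarrow> f (x, u) \<in> X \<Longrightarrow>
      \<alpha> (orbit_dist Q (x, u)) \<le> c (x, u) + lam x - lam (f (x, u))"
    and orbit: "Q \<in> periodic_orbits X U f (length Q)" and Q_nonempty: "Q \<noteq> []"
    and minimal: "minimal_orbit Q"
begin

abbreviation p :: nat where "p \<equiv> length Q"

definition rotated :: "'x \<times> 'u \<Rightarrow> real" where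
  "rotated w = c w + lam (fst w) - lam (f w)"

definition lam_mean :: real where
  "lam_mean = (\<Sum>k<p. lam (fst (Q ! k))) / p"

text \<open>Dissipativity and continuity of \<open>lam \<circ> f\<close> are available only where
  the successor stays in \<open>X\<close>; admissible trajectories run through this set.\<close>

definition Z :: "('x \<times> 'u) set" where "Z = {w \<in> X \<times> U. f w \<in> X}"

lemma p_pos: "p > 0" using Q_nonempty by simp

lemma U_nonempty: "U \<noteq> {}"
  using orbit Q_nonempty by (cases Q) (auto simp: periodic_orbits_def)

lemma lambar_nonneg: "x \<in> X \<Longrightarrow> 0 \<le> lambar"
  using lam_bound[of x] by linarith

lemma orbit_in_Z: "k < p \<Longrightarrow> Q ! k \<in> Z"
  and orbit_step: "k < p \<Longrightarrow> f (Q ! k) = fst (Q ! (Suc k mod p))"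
proof -
  have 1: "Q ! k \<in> X \<times> U" if "k < p" for k
    using orbit nth_mem[OF that] unfolding periodic_orbits_def by blast
  have 2: "f (Q ! k) = fst (Q ! (Suc k mod p))" if "k < p" for k
    using orbit that by (auto simp: periodic_orbits_def)
  show "f (Q ! k) = fst (Q ! (Suc k mod p))" if "k < p" using 2[OF that] .
  show "Q ! k \<in> Z" if "k < p"
    using 1[OF that] 2[OF that] 1[of "Suc k mod p"] p_pos by (auto simp: Z_def mem_Times_iff)
qed

lemma admissible_in_Z:
  "u \<in> admissible X U f N x \<Longrightarrow> k < N \<Longrightarrow> (traj f u x k, u k) \<in> Z"
  by (auto simp: Z_def admissible_def simp flip: traj.simps(2))

lemma continuous_on_rotated: "continuous_on Z rotated"
proof -
  have "Z \<subseteq> X \<times> U" by (auto simp: Z_def)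
  note cont = continuous_on_subset[OF _ this]
  have "continuous_on Z (lam \<circ> fst)"
    by (intro continuous_on_compose continuous_intros continuous_on_subset[OF cont_lam])
       (auto simp: Z_def)
  moreover have "continuous_on Z (lam \<circ> f)"
    by (intro continuous_on_compose cont[OF cont_f] continuous_on_subset[OF cont_lam])
       (auto simp: Z_def)
  ultimately show ?thesis
    unfolding rotated_def[abs_def] using cont[OF cont_c] by (auto intro!: continuous_intros simp: o_def)
qed

section \<open>Small rotated cost forces closeness to the orbit\<close>

lemma orbit_dist_attained: "\<exists>j<p. orbit_dist Q w = norm (w - Q ! j)"
proof -
  have "orbit_dist Q w \<in> (\<lambda>k. norm (w - Q ! k)) ` {..<p}"
    unfolding orbit_dist_def using p_pos by (intro Min_in) auto
  thus ?thesis by auto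
qed

lemma rotated_nonneg: "w \<in> Z \<Longrightarrow> 0 \<le> rotated w"
  and rotated_nonpos: "w \<in> Z \<Longrightarrow> rotated w \<le> 0 \<Longrightarrow> \<exists>j<p. w = Q ! j"
proof -
  obtain j where j: "j < p" "orbit_dist Q w = norm (w - Q ! j)" using orbit_dist_attained by blast
  have ge: "\<alpha> (norm (w - Q ! j)) \<le> rotated w" if "w \<in> Z"
    using dissipative[of "fst w" "snd w"] that j by (auto simp: Z_def rotated_def)
  show "0 \<le> rotated w" if "w \<in> Z"
  proof -
    have "0 \<le> \<alpha> (norm (w - Q ! j))" using \<alpha> by (auto simp: class_K_inf_def Pi_iff)
    thus ?thesis using ge[OF that] by linarith
  qed
  show "\<exists>j<p. w = Q ! j" if "w \<in> Z" "rotated w \<le> 0"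
  proof (rule ccontr)
    assume "\<not> (\<exists>j<p. w = Q ! j)"
    hence "0 < norm (w - Q ! j)" using j by auto
    hence "\<alpha> 0 < \<alpha> (norm (w - Q ! j))"
      using \<alpha> by (intro strict_mono_onD[of "{0..}" \<alpha>]) (auto simp: class_K_inf_def)
    thus False using ge that \<alpha> by (auto simp: class_K_inf_def)
  qed
qed

text \<open>Zero rotated cost puts each pair on the orbit. By minimality the state alone determines
  the index, so the dynamics advance the index by one at each step.\<close>

lemma follows_orbit:
  assumes u: "u \<in> admissible X U f H x" and "0 < H"
    and small: "\<And>k. k < H \<Longrightarrow> rotated (traj f u x k, u k) \<le> 0"
  shows "\<exists>j<p. \<forall>k<H. (traj f u x k, u k) = Q ! ((j + k) mod p)"
proof -
  have near: "\<exists>i<p. (traj f u x k, u k) = Q ! i" if "k < H" for k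
    using rotated_nonpos[OF admissible_in_Z[OF u that] small[OF that]] .
  from near[OF \<open>0 < H\<close>] obtain j where j: "j < p" "(traj f u x 0, u 0) = Q ! j" by blast
  have "(traj f u x k, u k) = Q ! ((j + k) mod p)" if "k < H" for k
    using that
  proof (induction k)
    case (Suc k)
    from near[OF Suc.prems] obtain i where i: "i < p" "(traj f u x (Suc k), u (Suc k)) = Q ! i" by blast
    have "fst (Q ! i) = traj f u x (Suc k)" using i by (metis fst_conv)
    also have "\<dots> = f (Q ! ((j + k) mod p))" using Suc by simp
    also have "\<dots> = fst (Q ! ((j + Suc k) mod p))"
      using p_pos by (subst orbit_step) (auto simp: mod_Suc_eq)
    finally have "i = (j + Suc k) mod p"
      using minimal i p_pos by (auto simp: minimal_orbit_def)
    thus ?case using i by simp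
  qed (use j in auto)
  thus ?thesis using j by blast
qed

text \<open>Otherwise \<open>p\<close>-step trajectories with rotated costs tending to 0 would have
  a limit that follows the orbit. Its starting index is unknown, but a sum over a full period does
  not depend on it. The function \<open>h\<close> is later both \<open>lam\<close> of the state and
  \<open>rotated\<close> itself.\<close>

lemma near_orbit:
  assumes h: "continuous_on Z h" and e: "(0::real) < e"
  shows "\<exists>\<delta>>0. \<forall>x\<in>X. \<forall>u\<in>admissible X U f p x.
    (\<forall>k<p. rotated (traj f u x k, u k) \<le> \<delta>) \<longrightarrow>
    \<bar>(\<Sum>k<p. h (traj f u x k, u k)) - (\<Sum>k<p. h (Q ! k))\<bar> < e"
proof (rule ccontr)
  define bad where "bad \<delta> x u \<longleftrightarrow> x \<in> X \<and> u \<in> admissible X U f p x \<and>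
     (\<forall>k<p. rotated (traj f u x k, u k) \<le> \<delta>) \<and>
     \<not> \<bar>(\<Sum>k<p. h (traj f u x k, u k)) - (\<Sum>k<p. h (Q ! k))\<bar> < e" for \<delta> x u
  assume "\<not> ?thesis"
  hence "\<forall>\<delta>>0. \<exists>x u. bad \<delta> x u" unfolding bad_def by blast
  hence "\<forall>n::nat. \<exists>x u. bad (1 / Suc n) x u" by simp
  then obtain x u where "\<And>n::nat. bad (1 / Suc n) (x n) (u n)" by metis
  hence x: "\<And>n::nat. x n \<in> X" and u: "\<And>n. u n \<in> admissible X U f p (x n)"
    and small: "\<And>n k. k < p \<Longrightarrow> rotated (traj f (u n) (x n) k, u n k) \<le> 1 / Suc n"
    and far: "\<And>n. \<bar>(\<Sum>k<p. h (traj f (u n) (x n) k, u n k)) - (\<Sum>k<p. h (Q ! k))\<bar> \<ge> e"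
    unfolding bad_def not_less by blast+
  obtain r x' u' where r: "strict_mono (r :: nat \<Rightarrow> nat)" and "x' \<in> X"
    and u'_adm: "\<And>H. \<forall>\<^sub>F n in sequentially. H \<le> p \<Longrightarrow> u' \<in> admissible X U f H x'"
    and lims: "\<And>H k. \<forall>\<^sub>F n in sequentially. H \<le> p \<Longrightarrow> k \<le> H \<Longrightarrow>
       (\<lambda>n. traj f (u (r n)) (x (r n)) k) \<longlonglongrightarrow> traj f u' x' k"
    "\<And>H k. \<forall>\<^sub>F n in sequentially. H \<le> p \<Longrightarrow> k < H \<Longrightarrow> (\<lambda>n. u (r n) k) \<longlonglongrightarrow> u' k"
    by (rule admissible_limit[where x = x and u = u and N = "\<lambda>_. p",
          OF compact_X compact_U U_nonempty cont_f x u]) (rule that; assumption)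
  have u': "u' \<in> admissible X U f p x'" by (intro u'_adm) simp
  have lim: "(\<lambda>n. traj f (u (r n)) (x (r n)) k) \<longlonglongrightarrow> traj f u' x' k"
    "(\<lambda>n. u (r n) k) \<longlonglongrightarrow> u' k" if "k < p" for k
    using lims[of p k] that by auto
  have lim_g: "(\<lambda>n. g (traj f (u (r n)) (x (r n)) k, u (r n) k)) \<longlonglongrightarrow> g (traj f u' x' k, u' k)"
    if "continuous_on Z g" "k < p" for g :: "_ \<Rightarrow> real" and k
    using admissible_in_Z[OF u] admissible_in_Z[OF u'] lim that
    by (intro continuous_on_tendsto_compose[OF that(1)] tendsto_Pair always_eventually allI) auto
  have "rotated (traj f u' x' k, u' k) \<le> 0" if "k < p" for k
  proof (rule LIMSEQ_le[OF lim_g[OF continuous_on_rotated that]])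
    show "(\<lambda>n. 1 / real (Suc (r n))) \<longlonglongrightarrow> 0"
      using LIMSEQ_subseq_LIMSEQ[OF LIMSEQ_inverse_real_of_nat r] by (simp add: o_def inverse_eq_divide)
  qed (use small that in blast)
  then obtain j where "\<forall>k<p. (traj f u' x' k, u' k) = Q ! ((j + k) mod p)"
    using follows_orbit[OF u' p_pos] by blast
  hence eq: "(\<Sum>k<p. h (traj f u' x' k, u' k)) = (\<Sum>k<p. h (Q ! k))"
    using sum_rotate[of "\<lambda>k. h (Q ! k)"] by simp
  have "(\<lambda>n. \<bar>(\<Sum>k<p. h (traj f (u (r n)) (x (r n)) k, u (r n) k)) - (\<Sum>k<p. h (Q ! k))\<bar>)
      \<longlonglongrightarrow> \<bar>(\<Sum>k<p. h (traj f u' x' k, u' k)) - (\<Sum>k<p. h (Q ! k))\<bar>"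
    by (intro tendsto_intros lim_g h) auto
  hence "e \<le> 0" unfolding eq using far by (intro LIMSEQ_le_const) auto
  thus False using e by simp
qed

section \<open>Summation by parts and convergence of the weighted storage term\<close>

lemma rotated_sum_by_parts:
  assumes "\<beta> 0 = 1" "\<beta> 1 = 0" "0 < N"
  shows "(\<Sum>k<N. \<beta> (k / N) * c (traj f u x k, u k))
    = (\<Sum>k<N. \<beta> (k / N) * rotated (traj f u x k, u k)) - lam x
      + (\<Sum>k<N. decrement \<beta> N k * lam (traj f u x (Suc k)))"
proof -
  define b where "b k = \<beta> (real k / N)" for k
  define y where "y k = lam (traj f u x k)" for k
  \<comment> \<open>The generalisation to \<open>n\<close> makes induction possible; the boundary
    term \<open>b n * y n\<close> vanishes at \<open>n = N\<close> because
    \<open>\<beta> 1 = 0\<close>.\<close>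
  have "(\<Sum>k<n. b k * c (traj f u x k, u k)) = (\<Sum>k<n. b k * rotated (traj f u x k, u k))
      - b 0 * y 0 + b n * y n + (\<Sum>k<n. decrement \<beta> N k * y (Suc k))" for n
    by (induction n) (auto simp: rotated_def decrement_def b_def y_def algebra_simps)
  from this[of N] show ?thesis
    using assms by (simp add: b_def y_def)
qed

lemma state_lambar_nonneg: "0 \<le> lambar"
  using orbit_in_Z[OF p_pos] lambar_nonneg by (auto simp: Z_def)

lemma lam_mean_bound: "\<bar>lam_mean\<bar> \<le> lambar"
proof -
  have "\<bar>\<Sum>k<p. lam (fst (Q ! k))\<bar> \<le> (\<Sum>k<p. lambar)"
    using orbit_in_Z by (intro order.trans[OF sum_abs] sum_mono lam_bound) (auto simp: Z_def mem_Times_iff)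
  thus ?thesis using p_pos by (simp add: lam_mean_def field_simps)
qed

lemma continuous_on_lam_fst: "continuous_on Z (\<lambda>w. lam (fst w))"
  by (intro continuous_on_compose2[OF cont_lam] continuous_intros) (auto simp: Z_def)

text \<open>Windows of \<open>p\<close> steps with small rotated cost have a mean of
  \<open>lam\<close> near \<open>lam_mean\<close>. The budget \<open>B\<close> limits the other
  windows wherever \<open>\<beta>\<close> is bounded away from 0; near the end of the horizon, where
  \<open>\<beta>\<close> is small, the total weight is small instead. The bound \<open>N0\<close> is
  uniform in the initial state and the control.\<close>

lemma storage_average:
  assumes reg: "regular_discount \<beta> L" and e: "0 < e"
  shows "\<exists>N0>0. \<forall>N\<ge>N0. \<forall>x\<in>X. \<forall>u\<in>admissible X U f N x.
    (\<Sum>k<N. \<beta> (k / N) * rotated (traj f u x k, u k)) \<le> B \<longrightarrow>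
    \<bar>(\<Sum>k<N. decrement \<beta> N k * lam (traj f u x (Suc k))) - lam_mean\<bar> \<le> e"
proof -
  have lip: "L-lipschitz_on {0..1} \<beta>" and anti: "antimono_on {0..1} \<beta>" and \<beta>01: "\<beta> 0 = 1" "\<beta> 1 = 0"
    and \<beta>pos: "\<And>\<xi>. \<xi> \<in> {0..<1} \<Longrightarrow> 0 < \<beta> \<xi>" and var: "decrement_variation \<beta> \<longlonglongrightarrow> 0"
    using reg by (auto simp: regular_discount_def)
  have L: "0 \<le> L" using lip by (rule lipschitz_on_nonneg)
  note Y = state_lambar_nonneg
  obtain \<delta> where \<delta>: "0 < \<delta>" "\<And>x u. x \<in> X \<Longrightarrow> u \<in> admissible X U f p x \<Longrightarrow>
      (\<And>k. k < p \<Longrightarrow> rotated (traj f u x k, u k) \<le> \<delta>) \<Longrightarrow>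
      \<bar>(\<Sum>k<p. lam (traj f u x k)) - (\<Sum>k<p. lam (fst (Q ! k)))\<bar> < p * (e / 4)"
    using near_orbit[OF continuous_on_lam_fst, of "p * (e / 4)"] e p_pos by fastforce
  \<comment> \<open>The last fraction \<open>\<eta>\<close> of the horizon has weight about
    \<open>L * \<eta>\<close> and a deviation of at most \<open>2 * lambar\<close>; this choice
    keeps its contribution below \<open>e / 4\<close>.\<close>
  define \<eta> where "\<eta> = e / (8 * lambar * L + e)"
  have den: "0 < 8 * lambar * L + e" using e Y L by (intro add_nonneg_pos) auto
  have \<eta>: "0 < \<eta>" "\<eta> \<le> 1" "2 * lambar * L * \<eta> \<le> e / 4"
    using e Y L den by (auto simp: \<eta>_def field_simps)
  \<comment> \<open>By monotonicity this is a lower bound for \<open>\<beta>\<close> up to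
    \<open>1 - \<eta>\<close>.\<close>
  define \<theta> where "\<theta> = \<beta> (1 - \<eta>)"
  have \<theta>: "0 < \<theta>" using \<beta>pos \<eta> by (simp add: \<theta>_def)
  \<comment> \<open>One step of discounted rotated cost at least \<open>\<theta> * \<delta>\<close>,
    multiplied by \<open>D\<close>, pays for the largest possible deviation
    \<open>2 * lambar\<close> of a window.\<close>
  define D where "D = 2 * lambar / (\<theta> * \<delta>)"
  have D: "0 \<le> D" using Y \<theta> \<delta> by (simp add: D_def)
  \<comment> \<open>Collects all errors of order \<open>1 / N\<close>: rounding in the count of late
    indices, windows paid for by the budget \<open>B\<close>, and boundary terms.\<close>
  define C where "C = 2 * lambar * L * (p + 1) + D * L * (p * B) + 4 * p * L * lambar"
  have "(\<lambda>N. C / real N) \<longlonglongrightarrow> 0" by (rule lim_const_over_n)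
  hence ev1: "\<forall>\<^sub>F N in sequentially. C / real N < e / 4" using e by (intro order_tendstoD) auto
  have "(\<lambda>N. p * lambar * decrement_variation \<beta> N) \<longlonglongrightarrow> p * lambar * 0" by (intro tendsto_intros var)
  hence ev2: "\<forall>\<^sub>F N in sequentially. p * lambar * decrement_variation \<beta> N < e / 4"
    using e by (intro order_tendstoD) auto
  have "\<forall>\<^sub>F N in sequentially. p < N \<and> C / real N < e / 4 \<and> p * lambar * decrement_variation \<beta> N < e / 4"
    using ev1 ev2 eventually_gt_at_top[of p] by eventually_elim auto
  then obtain N0 where N0: "\<And>N. N \<ge> N0 \<Longrightarrow> p < N \<and> C / real N < e / 4 \<and>
      p * lambar * decrement_variation \<beta> N < e / 4"
    unfolding eventually_sequentially by blast
  show ?thesis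
  proof (intro exI[of _ "Suc N0"] conjI allI impI ballI)
    fix N x u
    assume "N \<ge> Suc N0" and x: "x \<in> X" and u: "u \<in> admissible X U f N x"
      and cost: "(\<Sum>k<N. \<beta> (k / N) * rotated (traj f u x k, u k)) \<le> B"
    hence N: "p < N" "C / real N < e / 4" "p * lambar * decrement_variation \<beta> N < e / 4"
      using N0[of N] by auto
    have Npos: "0 < real N" using N by simp
    define w where "w = decrement \<beta> N"
    \<comment> \<open>Summation by parts pairs weight \<open>k\<close> with state
      \<open>k + 1\<close>. The default 0 beyond the horizon makes the bound \<open>lambar\<close>
      hold for every index.\<close>
    define y where "y k = (if k < N then lam (traj f u x (Suc k)) else 0)" for k
    define g where "g k = \<beta> (k / N) * rotated (traj f u x k, u k)" for k
    define a where "a k = (\<Sum>i<p. y (k + i)) / p" for k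
    \<comment> \<open>For \<open>k < M\<close> the window of times \<open>k + 1\<close> to
      \<open>k + p\<close> stays below \<open>N\<close>, so its states and controls are all
      admissible.\<close>
    define M where "M = N - p"
    have MN: "M + p = N" "M < N" using N p_pos by (auto simp: M_def)
    have in_X: "traj f u x k \<in> X" if "k \<le> N" for k using u that by (auto simp: admissible_def)
    have y: "\<bar>y k\<bar> \<le> lambar" for k using lam_bound[OF in_X[of "Suc k"]] Y by (simp add: y_def)
    have w_nonneg: "0 \<le> w k" if "k < N" for k using decrement_nonneg[OF anti that] by (simp add: w_def)
    have w_le: "\<bar>w k\<bar> \<le> L / N" if "k < N" for k using decrement_le[OF lip that] by (simp add: w_def)
    have w_sum: "(\<Sum>k<N. w k) = 1" using sum_decrement[of \<beta> N N] Npos \<beta>01 by (simp add: w_def)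
    have q_nonneg: "0 \<le> rotated (traj f u x k, u k)" if "k < N" for k
      using rotated_nonneg[OF admissible_in_Z[OF u that]] .
    have \<beta>_ge: "\<theta> \<le> \<beta> (k / N)" if "k / N \<le> 1 - \<eta>" for k :: nat
      using monotone_onD[OF anti, of "k / N" "1 - \<eta>"] that \<eta> by (simp add: \<theta>_def)
    have \<beta>_nonneg: "0 \<le> \<beta> (k / N)" if "k < N" for k :: nat
      using \<beta>pos[of "k / N"] that by simp
    have g_nonneg: "0 \<le> g k" if "k < N" for k
      using q_nonneg[OF that] \<beta>_nonneg[OF that] by (simp add: g_def)
    have tail: "(\<Sum>k<N. h k) - (\<Sum>k<M. h k) = (\<Sum>k\<in>{M..<N}. h k)" for h :: "nat \<Rightarrow> real"
      using MN by (subst sum_diff[symmetric]) (auto intro!: sum.cong)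
    have a_bound: "\<bar>a k\<bar> \<le> lambar" for k
    proof -
      have "\<bar>\<Sum>i<p. y (k + i)\<bar> \<le> (\<Sum>i<p. lambar)"
        using y by (intro order.trans[OF sum_abs] sum_mono)
      thus ?thesis using p_pos by (simp add: a_def field_simps)
    qed
    \<comment> \<open>If one of the next \<open>p\<close> steps has rotated cost above \<open>\<delta>\<close>, then it contributes at least \<open>\<theta> * \<delta>\<close>
      to the discounted rotated cost, except in the last fraction \<open>\<eta>\<close> of the horizon.\<close>
    have dev: "\<bar>a k - lam_mean\<bar> \<le> e / 4
        + (if (1 - \<eta>) * N - p < k then 2 * lambar else 0) + D * (\<Sum>i<p. g (k + Suc i))"
      if k: "k < M" for k
    proof -
      have g0: "0 \<le> g (k + Suc i)" if "i < p" for i using that k MN by (intro g_nonneg) auto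
      hence G0: "0 \<le> (\<Sum>i<p. g (k + Suc i))" by (intro sum_nonneg) auto
      have le2: "\<bar>a k - lam_mean\<bar> \<le> 2 * lambar" using a_bound[of k] lam_mean_bound by linarith
      show ?thesis
      proof (cases "\<forall>i<p. rotated (traj f u x (Suc k + i), u (Suc k + i)) \<le> \<delta>")
        case True
        define v where "v i = u (Suc k + i)" for i
        have v: "v \<in> admissible X U f p (traj f u x (Suc k))"
          unfolding v_def using admissible_shift[OF u, of "Suc k" p] k MN by simp
        have tv: "traj f v (traj f u x (Suc k)) i = traj f u x (Suc k + i)" for i
          unfolding v_def by (rule traj_shift[symmetric])
        have sum_y: "(\<Sum>i<p. lam (traj f v (traj f u x (Suc k)) i)) = (\<Sum>i<p. y (k + i))"
          unfolding tv using k MN by (intro sum.cong) (auto simp: y_def simp del: traj.simps)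
        have "\<bar>(\<Sum>i<p. lam (traj f v (traj f u x (Suc k)) i)) - (\<Sum>k<p. lam (fst (Q ! k)))\<bar> < p * (e / 4)"
          using True k MN by (intro \<delta>(2)[OF in_X v]) (auto simp: tv v_def simp del: traj.simps)
        hence "\<bar>(\<Sum>i<p. y (k + i)) - (\<Sum>k<p. lam (fst (Q ! k)))\<bar> / p < e / 4"
          unfolding sum_y using p_pos by (simp add: field_simps)
        hence "\<bar>a k - lam_mean\<bar> < e / 4"
          by (simp add: a_def lam_mean_def diff_divide_distrib[symmetric])
        thus ?thesis using Y D G0 by (smt (verit) mult_nonneg_nonneg)
      next
        case False
        then obtain i where i: "i < p" "\<delta> < rotated (traj f u x (Suc k + i), u (Suc k + i))" by auto
        show ?thesis
        proof (cases "(1 - \<eta>) * N - p < k")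
          case True
          thus ?thesis using le2 D G0 e by (smt (verit) mult_nonneg_nonneg divide_nonneg_pos)
        next
          case False
          hence "real (k + Suc i) \<le> (1 - \<eta>) * N" using i by linarith
          hence "\<theta> \<le> \<beta> (real (k + Suc i) / N)" using Npos by (intro \<beta>_ge) (simp add: field_simps)
          hence "\<theta> * \<delta> \<le> g (k + Suc i)"
            unfolding g_def using i \<theta> \<delta> by (intro mult_mono) auto
          also have "\<dots> \<le> (\<Sum>i<p. g (k + Suc i))"
            using i g0 by (intro member_le_sum) auto
          finally have "D * (\<theta> * \<delta>) \<le> D * (\<Sum>i<p. g (k + Suc i))" using D by (intro mult_left_mono)
          moreover have "D * (\<theta> * \<delta>) = 2 * lambar" using \<theta> \<delta> by (simp add: D_def)
          ultimately show ?thesis using le2 e False by simp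
        qed
      qed
    qed
    have cnt: "(\<Sum>k<M. if (1 - \<eta>) * N - p < k then 2 * lambar else 0) \<le> (\<eta> * N + p + 1) * (2 * lambar)"
    proof -
      let ?S = "{k::nat. (1 - \<eta>) * N - p < k \<and> k < real N}"
      have le: "(1 - \<eta>) * N - p \<le> real N" using \<eta> Npos by (simp add: algebra_simps)
      have "(\<Sum>k<M. if (1 - \<eta>) * N - p < k then 2 * lambar else 0)
          = card ({..<M} \<inter> {k. (1 - \<eta>) * N - p < k}) * (2 * lambar)"
        by (simp add: sum.If_cases)
      also have "\<dots> \<le> card ?S * (2 * lambar)"
        using Y MN card_nat_in_interval(1)[OF le]
        by (intro mult_right_mono) (auto intro!: card_mono)
      also have "\<dots> \<le> (\<eta> * N + p + 1) * (2 * lambar)"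
        using card_nat_in_interval(2)[OF le] Y by (intro mult_right_mono) (auto simp: algebra_simps)
      finally show ?thesis .
    qed
    \<comment> \<open>Every time belongs to at most \<open>p\<close> windows, so together they carry
      at most \<open>p\<close> times the budget.\<close>
    have "(\<Sum>k<M. \<Sum>i<p. g (k + Suc i)) = (\<Sum>i<p. \<Sum>k<M. g (k + Suc i))" by (rule sum.swap)
    also have "\<dots> \<le> (\<Sum>i<p. \<Sum>k<N. g k)"
    proof (rule sum_mono)
      fix i assume "i \<in> {..<p}"
      hence "(\<lambda>k. k + Suc i) ` {..<M} \<subseteq> {..<N}" using MN by auto
      moreover have "(\<Sum>k<M. g (k + Suc i)) = sum g ((\<lambda>k. k + Suc i) ` {..<M})"
        by (subst sum.reindex) (auto simp: o_def inj_on_def)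
      ultimately show "(\<Sum>k<M. g (k + Suc i)) \<le> (\<Sum>k<N. g k)"
        using g_nonneg by (auto intro!: sum_mono2)
    qed
    also have "\<dots> \<le> p * B" using cost by (simp add: g_def mult_left_mono)
    finally have G: "(\<Sum>k<M. \<Sum>i<p. g (k + Suc i)) \<le> p * B" .
    have "\<bar>(\<Sum>k<M. w k * a k) - (\<Sum>k<M. w k) * lam_mean\<bar> = \<bar>\<Sum>k<M. w k * (a k - lam_mean)\<bar>"
      by (simp add: sum_distrib_right sum_subtractf right_diff_distrib)
    also have "\<dots> \<le> (\<Sum>k<M. w k * (e / 4) + (L / N) * (if (1 - \<eta>) * N - p < k then 2 * lambar else 0)
        + (L / N) * (D * (\<Sum>i<p. g (k + Suc i))))"
    proof (rule order.trans[OF sum_abs sum_mono])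
      fix k assume "k \<in> {..<M}"
      hence k: "k < M" "k < N" using MN by auto
      have "0 \<le> (\<Sum>i<p. g (k + Suc i))" using k MN by (intro sum_nonneg g_nonneg) auto
      hence "w k * (D * (\<Sum>i<p. g (k + Suc i))) \<le> L / N * (D * (\<Sum>i<p. g (k + Suc i)))"
        using w_le[OF k(2)] D by (intro mult_right_mono) auto
      moreover have "w k * (if (1 - \<eta>) * N - p < k then 2 * lambar else 0)
          \<le> L / N * (if (1 - \<eta>) * N - p < k then 2 * lambar else 0)"
        using w_le[OF k(2)] Y by (intro mult_right_mono) auto
      moreover have "\<bar>w k * (a k - lam_mean)\<bar> \<le> w k * (e / 4
        + (if (1 - \<eta>) * N - p < k then 2 * lambar else 0) + D * (\<Sum>i<p. g (k + Suc i)))"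
        using dev[OF k(1)] w_nonneg[OF k(2)] by (simp add: abs_mult mult_left_mono)
      ultimately show "\<bar>w k * (a k - lam_mean)\<bar> \<le> w k * (e / 4)
        + (L / N) * (if (1 - \<eta>) * N - p < k then 2 * lambar else 0)
        + (L / N) * (D * (\<Sum>i<p. g (k + Suc i)))"
        unfolding distrib_left by linarith
    qed
    also have "\<dots> = (\<Sum>k<M. w k) * (e / 4)
        + (L / N) * (\<Sum>k<M. if (1 - \<eta>) * N - p < k then 2 * lambar else 0)
        + (L / N) * (D * (\<Sum>k<M. \<Sum>i<p. g (k + Suc i)))"
      by (simp only: sum.distrib sum_distrib_left sum_distrib_right)
    also have "\<dots> \<le> 1 * (e / 4) + (L / N) * ((\<eta> * N + p + 1) * (2 * lambar)) + (L / N) * (D * (p * B))"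
    proof (intro add_mono)
      have "(\<Sum>k<M. w k) \<le> (\<Sum>k<N. w k)" using MN w_nonneg by (intro sum_mono2) auto
      thus "(\<Sum>k<M. w k) * (e / 4) \<le> 1 * (e / 4)" using w_sum e by (intro mult_right_mono) auto
      show "(L / N) * (\<Sum>k<M. if (1 - \<eta>) * N - p < k then 2 * lambar else 0)
          \<le> (L / N) * ((\<eta> * N + p + 1) * (2 * lambar))"
        using L by (intro mult_left_mono cnt) auto
      show "(L / N) * (D * (\<Sum>k<M. \<Sum>i<p. g (k + Suc i))) \<le> (L / N) * (D * (p * B))"
        using L D by (intro mult_left_mono G) auto
    qed
    finally have 1: "\<bar>(\<Sum>k<M. w k * a k) - (\<Sum>k<M. w k) * lam_mean\<bar>
        \<le> e / 4 + (L / N) * ((\<eta> * N + p + 1) * (2 * lambar)) + (L / N) * (D * (p * B))" by simp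
    have tail_bound: "\<bar>\<Sum>k\<in>{M..<N}. w k * h k\<bar> \<le> p * (L / N * lambar)"
      if "\<And>k. \<bar>h k\<bar> \<le> lambar" for h
    proof -
      have "\<bar>\<Sum>k\<in>{M..<N}. w k * h k\<bar> \<le> (\<Sum>k\<in>{M..<N}. L / N * lambar)"
      proof (rule order.trans[OF sum_abs sum_mono])
        fix k assume "k \<in> {M..<N}"
        thus "\<bar>w k * h k\<bar> \<le> L / N * lambar"
          unfolding abs_mult using that w_le L by (intro mult_mono) auto
      qed
      also have "\<dots> = p * (L / N * lambar)" using MN by simp
      finally show ?thesis .
    qed
    have 2: "\<bar>(\<Sum>k<N. w k * y k) - (\<Sum>k<M. w k * y k)\<bar> \<le> p * (L / N * lambar)"
      unfolding tail using y by (rule tail_bound)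
    have "lam_mean - (\<Sum>k<M. w k) * lam_mean = (\<Sum>k<N. w k * lam_mean) - (\<Sum>k<M. w k * lam_mean)"
      using w_sum by (simp add: sum_distrib_right[symmetric])
    hence 3: "\<bar>lam_mean - (\<Sum>k<M. w k) * lam_mean\<bar> \<le> p * (L / N * lambar)"
      unfolding tail using tail_bound[of "\<lambda>_. lam_mean"] lam_mean_bound by simp
    have "\<bar>(\<Sum>k<M. w k * a k) - (\<Sum>k<M. w k * y k)\<bar>
        \<le> p * ((2 * (L / N) + (\<Sum>k<M. \<bar>w (Suc k) - w k\<bar>)) * lambar)"
      unfolding a_def using MN w_le by (intro weighted_sum_mean y p_pos) auto
    also have "\<dots> \<le> p * ((2 * (L / N) + decrement_variation \<beta> N) * lambar)"
    proof -
      have "{..<M} \<subseteq> {..<N - 1}" using MN by auto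
      thus ?thesis
        unfolding decrement_variation_def w_def[symmetric] using Y
        by (intro mult_left_mono mult_right_mono add_left_mono sum_mono2) auto
    qed
    finally have 4: "\<bar>(\<Sum>k<M. w k * a k) - (\<Sum>k<M. w k * y k)\<bar>
        \<le> p * ((2 * (L / N) + decrement_variation \<beta> N) * lambar)" .
    \<comment> \<open>Four errors: comparing window means with \<open>lam_mean\<close>, dropping the
      last \<open>p\<close> terms from the sum and from the total mass 1, and replacing values by
      window means.\<close>
    have "\<bar>(\<Sum>k<N. w k * y k) - lam_mean\<bar>
        \<le> e / 4 + (L / N) * ((\<eta> * N + p + 1) * (2 * lambar)) + (L / N) * (D * (p * B))
          + p * (L / N * lambar) + p * (L / N * lambar)
          + p * ((2 * (L / N) + decrement_variation \<beta> N) * lambar)"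
      using 1 2 3 4 by linarith
    also have "\<dots> = e / 4 + 2 * lambar * L * \<eta> + C / N + p * lambar * decrement_variation \<beta> N"
      using Npos by (simp add: C_def field_simps)
    also have "\<dots> \<le> e" using N \<eta> by linarith
    finally show "\<bar>(\<Sum>k<N. decrement \<beta> N k * lam (traj f u x (Suc k))) - lam_mean\<bar> \<le> e"
      by (simp add: w_def y_def)
  qed simp
qed

section \<open>Limits of the values\<close>

text \<open>On these controls the series of nonnegative rotated costs converges, so a real-valued
  infimum bounded below by 0 can be formed.\<close>

definition summable_controls :: "'x \<Rightarrow> (nat \<Rightarrow> 'u) set" where
  "summable_controls x =
     {u \<in> admissible_inf X U f x. summable (\<lambda>k. rotated (traj f u x k, u k))}"

definition rotated_value :: "'x \<Rightarrow> real" where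
  "rotated_value x = (INF u\<in>summable_controls x. \<Sum>k. rotated (traj f u x k, u k))"

lemma rotated_traj_nonneg:
  "u \<in> admissible_inf X U f x \<Longrightarrow> 0 \<le> rotated (traj f u x k, u k)"
  by (intro rotated_nonneg admissible_in_Z[of _ "Suc k"] admissible_inf_imp_admissible) auto

lemma rotated_value_le:
  assumes "u \<in> summable_controls x"
  shows "rotated_value x \<le> (\<Sum>k. rotated (traj f u x k, u k))"
  unfolding rotated_value_def
proof (rule cINF_lower[OF _ assms])
  show "bdd_below ((\<lambda>u. \<Sum>k. rotated (traj f u x k, u k)) ` summable_controls x)"
    by (intro bdd_belowI2[of _ 0] suminf_nonneg) (auto simp: summable_controls_def rotated_traj_nonneg)
qed

lemma append_summable_control:
  assumes u: "u \<in> admissible X U f K x" and v: "v \<in> summable_controls (traj f u x K)"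
  shows "append_control K u v \<in> summable_controls x"
proof -
  let ?w = "append_control K u v"
  have "rotated (traj f ?w x (k + K), ?w (k + K)) = rotated (traj f v (traj f u x K) k, v k)" for k
    using traj_append_control(2)[of f K u v x k] by (simp add: append_control_def add.commute)
  hence "summable (\<lambda>k. rotated (traj f ?w x k, ?w k))"
    using v by (subst summable_iff_shift[symmetric, of _ K]) (simp add: summable_controls_def)
  thus ?thesis
    using append_control_admissible_inf[OF u] v by (auto simp: summable_controls_def)
qed

lemma orbit_summable_control:
  assumes zero: "\<And>k. k < p \<Longrightarrow> rotated (Q ! k) = 0" and j: "j < p"
  shows "(\<lambda>k. snd (Q ! ((j + k) mod p))) \<in> summable_controls (fst (Q ! j))"
proof -
  let ?u = "\<lambda>k. snd (Q ! ((j + k) mod p))"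
  have t: "traj f ?u (fst (Q ! j)) k = fst (Q ! ((j + k) mod p))" for k
    using j p_pos by (induction k) (auto simp: orbit_step mod_Suc_eq)
  have "Q ! ((j + k) mod p) \<in> X \<times> U" for k
    using orbit_in_Z[of "(j + k) mod p"] p_pos by (auto simp: Z_def)
  hence "?u \<in> admissible_inf X U f (fst (Q ! j))"
    by (auto simp: admissible_inf_def t mem_Times_iff)
  thus ?thesis using zero p_pos by (simp add: summable_controls_def t)
qed

section \<open>The orbit has zero rotated cost\<close>

lemma sum_cost_eq:
  "(\<Sum>k<N. c (traj f u x k, u k)) = (\<Sum>k<N. rotated (traj f u x k, u k)) - lam x + lam (traj f u x N)"
  by (induction N) (auto simp: rotated_def)

text \<open>If a period of the orbit had positive rotated cost \<open>T\<close>, any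
  \<open>p\<close> consecutive admissible steps would cost at least some \<open>m > 0\<close>:
  either one step exceeds \<open>\<delta>\<close>, or the sum is near \<open>T\<close>. Then
  \<open>c\<close> would grow linearly along every trajectory from \<open>x\<close>, contradicting
  that the optimal average of the shifted cost is 0, which is expressed by
  \<open>avg\<close>.\<close>

lemma orbit_rotated_zero:
  assumes x: "x \<in> X"
    and avg: "\<And>\<eta>. (0::real) < \<eta> \<Longrightarrow> \<exists>u\<in>admissible_inf X U f x.
      \<exists>\<^sub>F N in sequentially. (\<Sum>k<N. c (traj f u x k, u k)) < \<eta> * N"
    and "k < p"
  shows "rotated (Q ! k) = 0"
proof (rule ccontr)
  assume nonzero: "rotated (Q ! k) \<noteq> 0"
  define T where "T = (\<Sum>k<p. rotated (Q ! k))"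
  have "0 < T" unfolding T_def
    using nonzero \<open>k < p\<close> rotated_nonneg[OF orbit_in_Z] by (intro sum_pos2[of _ k]) (auto simp: less_le)
  then obtain \<delta> where \<delta>: "0 < \<delta>" "\<And>x u. x \<in> X \<Longrightarrow> u \<in> admissible X U f p x \<Longrightarrow>
      (\<And>k. k < p \<Longrightarrow> rotated (traj f u x k, u k) \<le> \<delta>) \<Longrightarrow>
      \<bar>(\<Sum>k<p. rotated (traj f u x k, u k)) - T\<bar> < T / 2"
    using near_orbit[OF continuous_on_rotated, of "T / 2"] unfolding T_def by fastforce
  define m where "m = min \<delta> (T / 2)"
  have m: "0 < m" using \<open>0 < T\<close> \<delta> by (simp add: m_def)
  have block: "m \<le> (\<Sum>k<p. rotated (traj f u x k, u k))"
    if "x \<in> X" "u \<in> admissible X U f p x" for x u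
  proof (cases "\<forall>k<p. rotated (traj f u x k, u k) \<le> \<delta>")
    case True
    hence "\<bar>(\<Sum>k<p. rotated (traj f u x k, u k)) - T\<bar> < T / 2" by (intro \<delta>(2) that) auto
    thus ?thesis unfolding m_def abs_less_iff by linarith
  next
    case False
    then obtain i where i: "i < p" "\<delta> < rotated (traj f u x i, u i)" by auto
    have "rotated (traj f u x i, u i) \<le> (\<Sum>k<p. rotated (traj f u x k, u k))"
      using i rotated_nonneg[OF admissible_in_Z[OF that(2)]] by (intro member_le_sum) auto
    thus ?thesis using i by (simp add: m_def)
  qed
  \<comment> \<open>The rate \<open>m / (2 * p)\<close> is half of the growth rate forced by the
    block bound.\<close>
  obtain u where u: "u \<in> admissible_inf X U f x"
    and freq: "\<exists>\<^sub>F N in sequentially. (\<Sum>k<N. c (traj f u x k, u k)) < m / (2 * p) * N"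
    using avg[of "m / (2 * p)"] m p_pos by auto
  have blocks: "q * m \<le> (\<Sum>k<q * p. rotated (traj f u x k, u k))" for q :: nat
  proof (induction q)
    case (Suc q)
    define v where "v = (\<lambda>i. u (q * p + i))"
    have "v \<in> admissible X U f p (traj f u x (q * p))"
      unfolding v_def by (rule admissible_shift[OF admissible_inf_imp_admissible[OF u] order_refl])
    moreover have "traj f u x (q * p) \<in> X" using u by (auto simp: admissible_inf_def)
    ultimately have "m \<le> (\<Sum>k<p. rotated (traj f u x (q * p + k), u (q * p + k)))"
      using block[of "traj f u x (q * p)" v] unfolding v_def traj_shift[symmetric] by blast
    moreover have "(\<Sum>k<n + p'. g k) = (\<Sum>k<n. g k) + (\<Sum>k<p'. g (n + k))" for g :: "nat \<Rightarrow> real" and n p'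
      by (induction p') auto
    from this[of "\<lambda>k. rotated (traj f u x k, u k)" "q * p" p]
    have "(\<Sum>k<Suc q * p. rotated (traj f u x k, u k)) = (\<Sum>k<q * p. rotated (traj f u x k, u k))
        + (\<Sum>k<p. rotated (traj f u x (q * p + k), u (q * p + k)))"
      by (simp add: add.commute)
    ultimately show ?case using Suc by (simp add: algebra_simps)
  qed simp
  \<comment> \<open>Only complete blocks are counted, hence the loss of one block; the two storage
    terms cost at most \<open>2 * lambar\<close>.\<close>
  have bound: "(N / p - 1) * m - 2 * lambar \<le> (\<Sum>k<N. c (traj f u x k, u k))" for N :: nat
  proof -
    have "N / p - 1 \<le> real (N div p)"
      using floor_correct[of "real N / p"] by (simp add: floor_divide_of_nat_eq)
    hence "(N / p - 1) * m \<le> (N div p) * m" using m by (intro mult_right_mono) auto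
    also have "\<dots> \<le> (\<Sum>k<N div p * p. rotated (traj f u x k, u k))" by (rule blocks)
    also have "\<dots> \<le> (\<Sum>k<N. rotated (traj f u x k, u k))"
      using u by (intro sum_mono2) (auto simp: rotated_traj_nonneg intro: less_le_trans div_times_less_eq_dividend)
    moreover have "\<bar>lam x\<bar> \<le> lambar" "\<bar>lam (traj f u x N)\<bar> \<le> lambar"
      using u x by (auto intro!: lam_bound simp: admissible_inf_def)
    ultimately show ?thesis unfolding sum_cost_eq by linarith
  qed
  have "\<forall>\<^sub>F N in sequentially. (m + 2 * lambar) * (2 * p) / m < real N"
    using filterlim_real_sequentially by (simp add: filterlim_at_top_dense)
  from frequently_eventually_conj[OF freq this]
  obtain N where "(\<Sum>k<N. c (traj f u x k, u k)) < m / (2 * p) * N"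
    and "(m + 2 * lambar) * (2 * p) / m < real N"
    by (auto dest: frequently_ex)
  moreover from this(2) have "m + 2 * lambar < m / (2 * p) * N"
    using m p_pos by (simp add: field_simps)
  moreover have "(N / p - 1) * m = 2 * (m / (2 * p) * N) - m"
    using p_pos by (simp add: field_simps)
  ultimately show False using bound[of N] by linarith
qed

text \<open>Since \<open>\<beta>\<close> is at most 1, the discounted rotated cost stays below the
  full series, which also serves as the budget for \<open>storage_average\<close>.\<close>

lemma discounted_cost_upper:
  assumes reg: "regular_discount \<beta> L" and x: "x \<in> X" and u: "u \<in> summable_controls x" and e: "0 < e"
  shows "\<forall>\<^sub>F N in sequentially. (\<Sum>k<N. \<beta> (k / N) * c (traj f u x k, u k))
    \<le> (\<Sum>k. rotated (traj f u x k, u k)) - lam x + lam_mean + e"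
proof -
  let ?r = "\<lambda>k. rotated (traj f u x k, u k)"
  have u': "u \<in> admissible_inf X U f x" "summable ?r" using u by (auto simp: summable_controls_def)
  have anti: "antimono_on {0..1} \<beta>" and \<beta>01: "\<beta> 0 = 1" "\<beta> 1 = 0" using reg by (auto simp: regular_discount_def)
  have le: "(\<Sum>k<N. \<beta> (k / N) * ?r k) \<le> suminf ?r" for N
  proof -
    have "\<beta> (k / N) * ?r k \<le> 1 * ?r k" if "k < N" for k
      using monotone_onD[OF anti, of 0 "k / N"] that \<beta>01 rotated_traj_nonneg[OF u'(1)]
      by (intro mult_right_mono) auto
    hence "(\<Sum>k<N. \<beta> (k / N) * ?r k) \<le> sum ?r {..<N}" by (intro sum_mono) auto
    also have "\<dots> \<le> suminf ?r" using u' rotated_traj_nonneg by (intro sum_le_suminf) auto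
    finally show ?thesis .
  qed
  obtain N0 where N0: "0 < N0" "\<And>N. N0 \<le> N \<Longrightarrow>
      \<bar>(\<Sum>k<N. decrement \<beta> N k * lam (traj f u x (Suc k))) - lam_mean\<bar> \<le> e"
    using storage_average[OF reg e, of "suminf ?r"] x le admissible_inf_imp_admissible[OF u'(1)] by blast
  show ?thesis
  proof (rule eventually_sequentiallyI[of N0])
    fix N assume N: "N0 \<le> N"
    hence "0 < N" using N0(1) by simp
    from rotated_sum_by_parts[of \<beta>, OF \<beta>01 this, of u x] show "(\<Sum>k<N. \<beta> (k / N) * c (traj f u x k, u k))
      \<le> suminf ?r - lam x + lam_mean + e"
      using le[of N] N0(2)[OF N] by linarith
  qed
qed

text \<open>Controls that are too cheap for arbitrarily long horizons would have a limit control
  whose total rotated cost lies below \<open>rotated_value x\<close>.\<close>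

lemma discounted_cost_lower:
  assumes reg: "regular_discount \<beta> L" and x: "x \<in> X" and e: "0 < e"
  shows "\<forall>\<^sub>F N in sequentially. \<forall>u\<in>admissible X U f N x.
    rotated_value x - lam x + lam_mean - e \<le> (\<Sum>k<N. \<beta> (k / N) * c (traj f u x k, u k))"
proof (rule ccontr)
  define cost where "cost N u = (\<Sum>k<N. \<beta> (k / N) * c (traj f u x k, u k))" for N u
  define v where "v = rotated_value x - lam x + lam_mean"
  have lip: "L-lipschitz_on {0..1} \<beta>" and anti: "antimono_on {0..1} \<beta>" and \<beta>01: "\<beta> 0 = 1" "\<beta> 1 = 0"
    and \<beta>pos: "\<And>\<xi>. \<xi> \<in> {0..<1} \<Longrightarrow> 0 < \<beta> \<xi>"
    using reg by (auto simp: regular_discount_def)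
  \<comment> \<open>The budget comes from the crude estimate that the storage sum is at most
    \<open>lambar\<close> in absolute value. With the budget established, the sharp estimate
    \<open>e / 2\<close> becomes available.\<close>
  obtain N0 where N0: "0 < N0" "\<And>N u. N0 \<le> N \<Longrightarrow> u \<in> admissible X U f N x \<Longrightarrow>
      (\<Sum>k<N. \<beta> (k / N) * rotated (traj f u x k, u k)) \<le> v + 2 * lambar \<Longrightarrow>
      \<bar>(\<Sum>k<N. decrement \<beta> N k * lam (traj f u x (Suc k))) - lam_mean\<bar> \<le> e / 2"
    using storage_average[OF reg, of "e / 2" "v + 2 * lambar"] half_gt_zero[OF e] x by blast
  assume "\<not> ?thesis"
  hence "\<exists>\<^sub>F N in sequentially. \<exists>u. u \<in> admissible X U f N x \<and> cost N u < v - e"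
    by (simp add: frequently_def not_less cost_def v_def Ball_def)
  hence cheap: "\<exists>N\<ge>n. \<exists>u. u \<in> admissible X U f N x \<and> cost N u < v - e" for n
    unfolding frequently_sequentially by blast
  \<comment> \<open>The lower bound \<open>n + N0\<close> makes the horizons tend to infinity while
    \<open>storage_average\<close> applies to each of them.\<close>
  define good where "good n N u \<longleftrightarrow> n + N0 \<le> N \<and> u \<in> admissible X U f N x \<and> cost N u < v - e" for n N u
  have "\<forall>n. \<exists>N u. good n N u"
    unfolding good_def using cheap[of "n + N0" for n] by blast
  then obtain N u where "\<And>n. good n (N n) (u n)" by metis
  hence N: "\<And>n. n + N0 \<le> N n" and u: "\<And>n. u n \<in> admissible X U f (N n) x"
    and cost: "\<And>n. cost (N n) (u n) < v - e" unfolding good_def by blast+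
  have small: "(\<Sum>k<N n. \<beta> (k / N n) * rotated (traj f (u n) x k, u n k)) \<le> rotated_value x - e / 2"
    (is "?R n \<le> _") for n
  proof -
    define S where "S = (\<Sum>k<N n. decrement \<beta> (N n) k * lam (traj f (u n) x (Suc k)))"
    have Npos: "0 < N n" using N[of n] N0 by linarith
    have parts: "cost (N n) (u n) = ?R n - lam x + S"
      unfolding cost_def S_def by (rule rotated_sum_by_parts[OF \<beta>01 Npos])
    have "\<bar>S\<bar> \<le> (\<Sum>k<N n. decrement \<beta> (N n) k * lambar)"
      unfolding S_def
    proof (rule order.trans[OF sum_abs sum_mono])
      fix k assume k: "k \<in> {..<N n}"
      hence "traj f (u n) x (Suc k) \<in> X" using u[of n] by (simp add: admissible_def del: traj.simps)
      from lam_bound[OF this] show "\<bar>decrement \<beta> (N n) k * lam (traj f (u n) x (Suc k))\<bar>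
          \<le> decrement \<beta> (N n) k * lambar"
        using decrement_nonneg[OF anti, of k "N n"] k
        by (simp add: abs_mult mult_left_mono del: traj.simps)
    qed
    also have "\<dots> = lambar"
      using sum_decrement[of \<beta> "N n" "N n"] Npos \<beta>01 by (simp add: sum_distrib_right[symmetric])
    finally have "\<bar>S\<bar> \<le> lambar" .
    hence "?R n \<le> v + 2 * lambar" using parts cost[of n] lam_bound[OF x] e by linarith
    hence "\<bar>S - lam_mean\<bar> \<le> e / 2"
      unfolding S_def using N[of n] u by (intro N0(2)) auto
    thus ?thesis using parts cost[of n] unfolding v_def by linarith
  qed
  obtain r x' u' where r: "strict_mono (r :: nat \<Rightarrow> nat)"
    and u'_adm: "\<And>H. \<forall>\<^sub>F n in sequentially. H \<le> N n \<Longrightarrow> u' \<in> admissible X U f H x'"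
    and lims: "\<And>H k. \<forall>\<^sub>F n in sequentially. H \<le> N n \<Longrightarrow> k \<le> H \<Longrightarrow>
       (\<lambda>n. traj f (u (r n)) x k) \<longlonglongrightarrow> traj f u' x' k"
    "\<And>H k. \<forall>\<^sub>F n in sequentially. H \<le> N n \<Longrightarrow> k < H \<Longrightarrow> (\<lambda>n. u (r n) k) \<longlonglongrightarrow> u' k"
    by (rule admissible_limit[where x = "\<lambda>_. x" and u = u and N = N,
          OF compact_X compact_U U_nonempty cont_f x u]) (rule that; assumption)
  have N_ge: "\<forall>\<^sub>F n in sequentially. H \<le> N n" for H
    using eventually_ge_at_top[of H] by eventually_elim (rule order.trans[OF _ add_leD1[OF N]])
  note lim_t = lims(1)[OF N_ge order_refl] and lim_u = lims(2)[OF N_ge lessI]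
  have "x' = x" using lim_t[of 0] by (simp add: LIMSEQ_const_iff)
  hence u': "u' \<in> admissible X U f H x" for H using u'_adm[OF N_ge] by blast
  have u'_inf: "u' \<in> admissible_inf X U f x"
    using u' unfolding admissible_def admissible_inf_def by blast
  have "filterlim (\<lambda>n. real (N (r n))) at_top sequentially"
  proof (rule filterlim_at_top_mono[OF filterlim_real_sequentially])
    show "\<forall>\<^sub>F n in sequentially. real n \<le> real (N (r n))"
      using order.trans[OF seq_suble[OF r] add_leD1[OF N]] by (intro always_eventually allI of_nat_mono)
  qed
  hence N_lim: "(\<lambda>n. k / real (N (r n))) \<longlonglongrightarrow> 0" for k by (rule real_tendsto_divide_at_top[OF tendsto_const])
  have ev: "\<forall>\<^sub>F n in sequentially. k < N (r n)" for k
    using eventually_subseq[OF r N_ge[of "Suc k"]] by (simp add: Suc_le_eq)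
  \<comment> \<open>For fixed \<open>K\<close> the factors \<open>\<beta> (k / N)\<close> tend to
    \<open>\<beta> 0 = 1\<close>, and the terms beyond \<open>K\<close> are nonnegative and may be
    dropped.\<close>
  have partial: "(\<Sum>k<K. rotated (traj f u' x k, u' k)) \<le> rotated_value x - e / 2" for K
  proof (rule tendsto_upperbound)
    have \<beta>_lim: "(\<lambda>n. \<beta> (real k / N (r n))) \<longlonglongrightarrow> \<beta> 0" for k
      using ev[of k]
      by (intro continuous_on_tendsto_compose[OF lipschitz_on_continuous_on[OF lip] N_lim])
         (auto elim!: eventually_mono)
    have r_lim: "(\<lambda>n. rotated (traj f (u (r n)) x k, u (r n) k)) \<longlonglongrightarrow> rotated (traj f u' x k, u' k)" for k
      using lim_t[of k] lim_u[of k] ev[of k] admissible_in_Z[OF u] admissible_in_Z[OF u'[of "Suc k"], of k] \<open>x' = x\<close>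
      by (intro continuous_on_tendsto_compose[OF continuous_on_rotated] tendsto_Pair)
         (auto elim!: eventually_mono)
    have "(\<lambda>n. \<Sum>k<K. \<beta> (real k / N (r n)) * rotated (traj f (u (r n)) x k, u (r n) k))
        \<longlonglongrightarrow> (\<Sum>k<K. \<beta> 0 * rotated (traj f u' x k, u' k))"
      by (intro tendsto_sum tendsto_mult \<beta>_lim r_lim)
    thus "(\<lambda>n. \<Sum>k<K. \<beta> (real k / N (r n)) * rotated (traj f (u (r n)) x k, u (r n) k))
        \<longlonglongrightarrow> (\<Sum>k<K. rotated (traj f u' x k, u' k))" using \<beta>01 by simp
    show "\<forall>\<^sub>F n in sequentially. (\<Sum>k<K. \<beta> (real k / N (r n)) * rotated (traj f (u (r n)) x k, u (r n) k))
        \<le> rotated_value x - e / 2"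
      using ev[of K]
    proof eventually_elim
      case (elim n)
      have "0 \<le> \<beta> (real k / N (r n)) * rotated (traj f (u (r n)) x k, u (r n) k)" if "k < N (r n)" for k
        using rotated_nonneg[OF admissible_in_Z[OF u that]] \<beta>pos[of "real k / N (r n)"] that
        by (intro mult_nonneg_nonneg) auto
      hence "(\<Sum>k<K. \<beta> (real k / N (r n)) * rotated (traj f (u (r n)) x k, u (r n) k)) \<le> ?R (r n)"
        using elim by (intro sum_mono2) auto
      thus ?case using small[of "r n"] by linarith
    qed
  qed simp
  have "summable (\<lambda>k. rotated (traj f u' x k, u' k))"
    using partial rotated_traj_nonneg[OF u'_inf] by (intro summableI_nonneg_bounded) auto
  hence "u' \<in> summable_controls x" and "(\<Sum>k. rotated (traj f u' x k, u' k)) \<le> rotated_value x - e / 2"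
    using u'_inf partial by (auto simp: summable_controls_def intro: suminf_le_const)
  thus False using rotated_value_le[of u' x] e by linarith
qed

lemma near_optimal_control:
  assumes "summable_controls x \<noteq> {}" "0 < e"
  obtains u where "u \<in> summable_controls x"
    "(\<Sum>k. rotated (traj f u x k, u k)) < rotated_value x + e"
proof -
  have "rotated_value x < rotated_value x + e" using assms by simp
  from cInf_lessD[OF _ this[unfolded rotated_value_def]] assms show ?thesis
    by (auto simp: rotated_value_def intro: that)
qed

lemma discounted_value_tendsto:
  assumes reg: "regular_discount \<beta> L" and x: "x \<in> X" and ne: "summable_controls x \<noteq> {}"
  shows "(\<lambda>N. discounted_value X U f c \<beta> N x) \<longlonglongrightarrow> ereal (rotated_value x - lam x + lam_mean)"
proof (rule tendsto_ereal_sandwich)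
  fix e :: real assume e: "0 < e"
  obtain u where u: "u \<in> summable_controls x"
    "(\<Sum>k. rotated (traj f u x k, u k)) < rotated_value x + e / 2"
    using near_optimal_control[OF ne, of "e / 2"] e by auto
  have "\<forall>\<^sub>F N in sequentially. (\<Sum>k<N. \<beta> (k / N) * c (traj f u x k, u k))
    \<le> (\<Sum>k. rotated (traj f u x k, u k)) - lam x + lam_mean + e / 2"
    using e by (intro discounted_cost_upper[OF reg x u(1)]) auto
  with discounted_cost_lower[OF reg x e]
  show "\<forall>\<^sub>F N in sequentially. ereal (rotated_value x - lam x + lam_mean - e) \<le> discounted_value X U f c \<beta> N x
      \<and> discounted_value X U f c \<beta> N x \<le> ereal (rotated_value x - lam x + lam_mean + e)"
  proof eventually_elim
    case (elim N)
    have "u \<in> admissible X U f N x"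
      using u(1) by (auto simp: summable_controls_def intro: admissible_inf_imp_admissible)
    moreover have "(\<Sum>k<N. \<beta> (k / N) * c (traj f u x k, u k)) \<le> rotated_value x - lam x + lam_mean + e"
      using elim(2) u(2) by linarith
    ultimately have "discounted_value X U f c \<beta> N x \<le> ereal (rotated_value x - lam x + lam_mean + e)"
      unfolding discounted_value_def by (intro INF_lower2) auto
    moreover have "ereal (rotated_value x - lam x + lam_mean - e) \<le> discounted_value X U f c \<beta> N x"
      unfolding discounted_value_def using elim(1) by (intro INF_greatest) auto
    ultimately show ?case by blast
  qed
qed

text \<open>For a nearly optimal control, partial sums eventually above \<open>B\<close> would push
  their Cesaro means above the upper bound for the linear discount.\<close>

lemma liminf_value_le:
  assumes x: "x \<in> X" and ne: "summable_controls x \<noteq> {}"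
  shows "liminf_value X U f c x \<le> ereal (rotated_value x - lam x + lam_mean)"
proof (rule ccontr)
  assume "\<not> ?thesis"
  then obtain B where B: "rotated_value x - lam x + lam_mean < B" "ereal B < liminf_value X U f c x"
    using ereal_dense2[of "ereal (rotated_value x - lam x + lam_mean)"] by (auto simp: not_le)
  \<comment> \<open>A quarter of the gap: near-optimality, the Cesaro mean and the upper bound each
    lose one \<open>e\<close>.\<close>
  define e where "e = (B - (rotated_value x - lam x + lam_mean)) / 4"
  have e: "0 < e" using B by (simp add: e_def)
  obtain u where u: "u \<in> summable_controls x"
    "(\<Sum>k. rotated (traj f u x k, u k)) < rotated_value x + e"
    using near_optimal_control[OF ne e] .
  define s where "s n = (\<Sum>k\<le>n. c (traj f u x k, u k))" for n
  have mean: "(\<Sum>k<N. (1 - k / N) * c (traj f u x k, u k)) = (\<Sum>n<N. s n) / N" for N :: nat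
    unfolding mean_partial_sums[symmetric] s_def by simp
  have "ereal B < liminf (\<lambda>N. ereal (\<Sum>k<N. c (traj f u x k, u k)))"
    using B(2) u(1) unfolding liminf_value_def
    by (auto simp: summable_controls_def intro: less_le_trans[OF _ INF_lower])
  hence "\<forall>\<^sub>F N in sequentially. B < (\<Sum>k<N. c (traj f u x k, u k))"
    by (auto dest: less_LiminfD)
  hence "\<forall>\<^sub>F n in sequentially. B < s n"
    unfolding s_def lessThan_Suc_atMost[symmetric] by (subst eventually_sequentially_Suc)
  hence "\<forall>\<^sub>F n in sequentially. - s n \<le> - B" by eventually_elim auto
  from eventually_mean_le[OF this e]
  have "\<forall>\<^sub>F N in sequentially. B - e \<le> (\<Sum>n<N. s n) / N"
    by eventually_elim (simp add: sum_negf)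
  moreover have "\<forall>\<^sub>F N in sequentially. (\<Sum>n<N. s n) / N
      \<le> (\<Sum>k. rotated (traj f u x k, u k)) - lam x + lam_mean + e"
    using discounted_cost_upper[OF regular_discount_linear x u(1) e] unfolding mean .
  ultimately have "\<forall>\<^sub>F N in sequentially. B - e
      \<le> (\<Sum>k. rotated (traj f u x k, u k)) - lam x + lam_mean + e"
    by eventually_elim linarith
  hence "B - e \<le> (\<Sum>k. rotated (traj f u x k, u k)) - lam x + lam_mean + e" by simp
  thus False using u(2) B(1) by (simp add: e_def field_simps)
qed

text \<open>Here the lower bound, uniform over controls, applies to an arbitrary \<open>u\<close>.
  With \<open>liminf_value_le\<close> the common limit is enclosed between the two undiscounted
  values.\<close>

lemma limsup_value_ge:
  assumes x: "x \<in> X"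
  shows "ereal (rotated_value x - lam x + lam_mean) \<le> limsup_value X U f c x"
  unfolding limsup_value_def
proof (rule INF_greatest, rule ccontr)
  fix u assume u: "u \<in> admissible_inf X U f x"
    and "\<not> ereal (rotated_value x - lam x + lam_mean) \<le> limsup (\<lambda>N. ereal (\<Sum>k<N. c (traj f u x k, u k)))"
  then obtain B where B: "B < rotated_value x - lam x + lam_mean"
    "limsup (\<lambda>N. ereal (\<Sum>k<N. c (traj f u x k, u k))) < ereal B"
    using ereal_dense2[of _ "ereal (rotated_value x - lam x + lam_mean)"] by (auto simp: not_le)
  define e where "e = (rotated_value x - lam x + lam_mean - B) / 4"
  have e: "0 < e" using B by (simp add: e_def)
  define s where "s n = (\<Sum>k\<le>n. c (traj f u x k, u k))" for n
  have mean: "(\<Sum>k<N. (1 - k / N) * c (traj f u x k, u k)) = (\<Sum>n<N. s n) / N" for N :: nat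
    unfolding mean_partial_sums[symmetric] s_def by simp
  have "\<forall>\<^sub>F N in sequentially. (\<Sum>k<N. c (traj f u x k, u k)) < B"
    using B(2) by (auto dest: Limsup_lessD)
  hence "\<forall>\<^sub>F n in sequentially. s n < B"
    unfolding s_def lessThan_Suc_atMost[symmetric] by (subst eventually_sequentially_Suc)
  hence "\<forall>\<^sub>F n in sequentially. s n \<le> B" by eventually_elim auto
  from eventually_mean_le[OF this e] discounted_cost_lower[OF regular_discount_linear x e]
  have "\<forall>\<^sub>F N in sequentially. rotated_value x - lam x + lam_mean - e \<le> B + e"
  proof eventually_elim
    case (elim N)
    from elim(2)[rule_format, OF admissible_inf_imp_admissible[OF u]] elim(1) show ?case
      unfolding mean by linarith
  qed
  hence "rotated_value x - lam x + lam_mean - e \<le> B + e" by simp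
  thus False using B(1) by (simp add: e_def field_simps)
qed

end

section \<open>Equality of the limits\<close>

lemma frequently_average_lt:
  assumes "optimal_average_cost X U f l x = ereal lstar" "(0::real) < \<eta>"
  shows "\<exists>u\<in>admissible_inf X U f x. \<exists>\<^sub>F N in sequentially.
    (\<Sum>k<N. shifted_cost l lstar (traj f u x k, u k)) < \<eta> * N"
proof -
  have "optimal_average_cost X U f l x < ereal (lstar + \<eta>)" using assms by simp
  then obtain u where u: "u \<in> admissible_inf X U f x"
    and lt: "liminf (\<lambda>N. ereal (1 / real N * (\<Sum>k<N. l (traj f u x k, u k)))) < ereal (lstar + \<eta>)"
    unfolding optimal_average_cost_def INF_less_iff by blast
  have "\<exists>\<^sub>F N in sequentially. 1 / real N * (\<Sum>k<N. l (traj f u x k, u k)) < lstar + \<eta>"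
    using lt Liminf_bounded[of "ereal (lstar + \<eta>)" "\<lambda>N. ereal (1 / real N * (\<Sum>k<N. l (traj f u x k, u k)))" sequentially]
    by (auto simp: frequently_def not_less)
  from frequently_eventually_conj[OF this eventually_gt_at_top[of 0]]
  have "\<exists>\<^sub>F N in sequentially. (\<Sum>k<N. shifted_cost l lstar (traj f u x k, u k)) < \<eta> * N"
    by (rule frequently_elim1) (auto simp: shifted_cost_def sum_subtractf field_simps)
  thus ?thesis using u by blast
qed

lemma orbit_state_dist_attained:
  assumes "Q \<noteq> []"
  shows "\<exists>j<length Q. orbit_state_dist Q x = norm (x - fst (Q ! j))"
proof -
  have "orbit_state_dist Q x \<in> (\<lambda>k. norm (x - fst (Q ! k))) ` {..<length Q}"
    unfolding orbit_state_dist_def using assms by (intro Min_in) auto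
  thus ?thesis by auto
qed

theorem theorem23:
  fixes X :: "(real^'n) set" and U :: "(real^'m) set"
    and f :: "(real^'n) \<times> (real^'m) \<Rightarrow> real^'n"
    and l :: "(real^'n) \<times> (real^'m) \<Rightarrow> real"
    and lstar :: real
    and Q :: "((real^'n) \<times> (real^'m)) list"
    and \<kappa> :: real
    and \<beta> :: "real \<Rightarrow> real"
  assumes lstar: "\<And>x. x \<in> X \<Longrightarrow> optimal_average_cost X U f l x = ereal lstar"
    and "continuity_compactness X U f l"
    and "strict_dissipativity X U f l lstar Q"
    and "local_controllability X U f Q \<kappa>"
    and "finite_time_reachability X U f Q \<kappa>"
    and "discount_function \<beta>"
  shows "(\<forall>x\<in>X.
            (\<exists>v::real. (\<lambda>N. discounted_value X U f (shifted_cost l lstar) \<beta> N x) \<longlonglongrightarrow> ereal v) \<and>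
            (\<exists>w::real. (\<lambda>N. cesaro_value X U f (shifted_cost l lstar) N x) \<longlonglongrightarrow> ereal w) \<and>
            discounted_value_inf X U f (shifted_cost l lstar) \<beta> x
              = cesaro_value_inf X U f (shifted_cost l lstar) x)
       \<and> ((\<forall>x\<in>X. limsup_value X U f (shifted_cost l lstar) x
                  = liminf_value X U f (shifted_cost l lstar) x)
           \<longrightarrow> (\<forall>x\<in>X. limsup_value X U f (shifted_cost l lstar) x
                      = cesaro_value_inf X U f (shifted_cost l lstar) x))"
proof -
  let ?c = "shifted_cost l lstar"
  have cc: "continuous_on (X \<times> U) f" "continuous_on (X \<times> U) l" "compact (X \<times> U)"
    using assms(2) by (auto simp: continuity_compactness_def)
  obtain lam lambar \<alpha> where sd: "minimal_orbit Q" "optimal_orbit X U f l Q"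
      "continuous_on X lam" "\<And>x. x \<in> X \<Longrightarrow> \<bar>lam x\<bar> \<le> lambar" "class_K_inf \<alpha>"
    and diss: "\<And>x u. x \<in> X \<Longrightarrow> u \<in> admissible X U f 1 x \<Longrightarrow>
      \<alpha> (orbit_dist Q (x, u 0)) \<le> ?c (x, u 0) + lam x - lam (f (x, u 0))"
    using assms(3) unfolding strict_dissipativity_def by blast
  have Q: "Q \<in> periodic_orbits X U f (length Q)" "Q \<noteq> []"
    using sd(2) by (auto simp: optimal_orbit_def periodic_orbits_def)
  hence "set Q \<subseteq> X \<times> U" "hd Q \<in> set Q" by (auto simp: periodic_orbits_def)
  \<comment> \<open>Both factors must be nonempty for the projections of the compact product to be
    all of \<open>X\<close> and \<open>U\<close>.\<close>
  hence "X \<noteq> {}" "U \<noteq> {}" by auto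
  hence "fst ` (X \<times> U) = X" "snd ` (X \<times> U) = U" by auto
  hence compact: "compact X" "compact U"
    using compact_continuous_image[OF continuous_on_fst[OF continuous_on_id] cc(3)]
      compact_continuous_image[OF continuous_on_snd[OF continuous_on_id] cc(3)] by auto
  interpret dissipative_orbit X U f ?c lam lambar \<alpha> Q
  proof
    show "\<alpha> (orbit_dist Q (x, u)) \<le> ?c (x, u) + lam x - lam (f (x, u))"
      if "x \<in> X" "u \<in> U" "f (x, u) \<in> X" for x u
      using diss[of x "\<lambda>_. u"] that by (auto simp: admissible_def le_Suc_eq)
    show "continuous_on (X \<times> U) ?c"
      unfolding shifted_cost_def[abs_def] by (intro continuous_intros cc)
  qed (use compact cc sd Q in auto)
  \<comment> \<open>Steer close to the orbit, then exactly onto the nearest orbit state by taking it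
    as both center and target in local controllability, then follow the orbit at zero rotated
    cost.\<close>
  have controllable: "summable_controls x \<noteq> {}" if x: "x \<in> X" for x
  proof -
    obtain K u where u: "u \<in> admissible X U f K x" "orbit_state_dist Q (traj f u x K) \<le> \<kappa>"
      using assms(5) x unfolding finite_time_reachability_def by blast
    obtain j where j: "j < p" "norm (traj f u x K - fst (Q ! j)) \<le> \<kappa>"
      using orbit_state_dist_attained[OF Q(2), of "traj f u x K"] u(2) by auto
    have "fst (Q ! j) \<in> X" "fst (Q ! j) \<in> set (map fst Q)"
      using orbit_in_Z[OF j(1)] j(1) by (auto simp: Z_def)
    moreover have "0 \<le> \<kappa>" using assms(4) by (simp add: local_controllability_def)
    moreover have "traj f u x K \<in> X" using u by (auto simp: admissible_def)
    ultimately obtain M v where v: "v \<in> admissible X U f M (traj f u x K)"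
      "traj f v (traj f u x K) M = fst (Q ! j)"
      using assms(4) j(2) unfolding local_controllability_def by (metis diff_self norm_zero)
    have zero: "rotated (Q ! k) = 0" if "k < p" for k
      using orbit_rotated_zero[OF x frequently_average_lt[OF lstar[OF x]] that] .
    show ?thesis
      using append_summable_control[OF u(1) append_summable_control[OF v(1)]]
        orbit_summable_control[OF zero j(1)] unfolding v(2) by blast
  qed
  obtain L where reg: "regular_discount \<beta> L" using discount_function_regular[OF assms(6)] .
  define V where "V x = rotated_value x - lam x + lam_mean" for x
  have disc: "(\<lambda>N. discounted_value X U f ?c \<beta> N x) \<longlonglongrightarrow> ereal (V x)"
    and ces: "(\<lambda>N. cesaro_value X U f ?c N x) \<longlonglongrightarrow> ereal (V x)" if "x \<in> X" for x
    using discounted_value_tendsto[OF _ that controllable[OF that]] reg regular_discount_linear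
    unfolding V_def cesaro_eq_discounted by blast+
  have "limsup_value X U f ?c x = ereal (V x)"
    if "limsup_value X U f ?c x = liminf_value X U f ?c x" "x \<in> X" for x
    using limsup_value_ge[OF that(2)] liminf_value_le[OF that(2) controllable[OF that(2)]] that(1)
    unfolding V_def by simp
  moreover have "discounted_value_inf X U f ?c \<beta> x = ereal (V x)"
    "cesaro_value_inf X U f ?c x = ereal (V x)" if "x \<in> X" for x
    unfolding discounted_value_inf_def cesaro_value_inf_def
    using disc[OF that] ces[OF that] by (auto intro: limI)
  ultimately show ?thesis using disc ces by metis
qed

end
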